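(* Let $C\ge 1$ be an integer and let $X, X_1, X_2,\dots$ be iid. For each $N\ge 1$ and each $i=1,\dots,C$, let $D_i^{(N)}\subseteq\{1,\dots,N\}$ be a (deterministic) subset with $|D_i^{(N)}|=n_i^{(N)}$, and let $T_i^{(N)}=T_i\big((X_j)_{j\in D_i^{(N)}}\big)$ be a statistic computed on the sample indexed by $D_i^{(N)}$, estimating a parameter $\theta_i$ and asymptotically linear with influence function $\psi_i$. Define $r_i(N)=n_i^{(N)}/N$ and $\omega_{ij}(N)=|D_i^{(N)}\cap D_j^{(N)}|/N$. Assume that as $N\to\infty$, $N r_i(N)\to\infty$ for every $i$, and for all $1\le i,j\le C$ $$\frac{\omega_{ij}(N)}{\sqrt{r_i(N)r_j(N)}}\to\varrho_{ij}.$$ Let $S_i^{(N)}=\sqrt{n_i^{(N)}}\,\big(T_i^{(N)}-\theta_i\big)$. Then $$\big(S_1^{(N)},\dots,S_C^{(N)}\big)\xrightarrow{d}\mathcal N_C(0,\Sigma),$$ where $\Sigma\in\mathbb R^{C\times C}$ has entries $\Sigma_{ij}=\varrho_{ij}\,\mathbb E[\psi_i(X)\psi_j(X)]$ for all $1\le i,j\le C$.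
   Context: A sequence of statistics $T^n=T^n(X_1,\dots,X_n)$ estimating a parameter $\theta$ is asymptotically linear with influence function $\psi$ if $T^n-\theta=\frac1n\sum_{i=1}^n\psi(X_i)+o_p(n^{-1/2})$ as $n\to\infty$, where $\mathbb E[\psi(X)]=0$ and $\operatorname{Var}[\psi(X)]<\infty$. For the statistics $T_i$ applied to the subsample indexed by $D_i^{(N)}$ this means $T_i^{(N)}-\theta_i=\frac{1}{n_i^{(N)}}\sum_{j\in D_i^{(N)}}\psi_i(X_j)+o_p\big((n_i^{(N)})^{-1/2}\big)$. $\mathcal N_C(0,\Sigma)$ denotes the (possibly degenerate) $C$-variate normal law. *)

theory Defs
  imports "HOL-Probability.Probability"
begin

definition std_normal_vec :: "(real ^ 'n) measure" where
  "std_normal_vec = density lborel (\<lambda>x. ennreal (\<Prod>i\<in>UNIV. std_normal_density (x $ i)))"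

text \<open>
  The law with mean \<open>m\<close> and covariance matrix \<open>\<Sigma>\<close> of an affine image \<open>m + A Z\<close> of a standard normal
  vector. Singular \<open>A\<close> are allowed, so degenerate normal laws are included. A law satisfying the
  predicate exists only if \<open>\<Sigma>\<close> is symmetric and positive semidefinite.
\<close>

definition multivariate_normal :: "real ^ 'n \<Rightarrow> real ^ 'n ^ 'n \<Rightarrow> (real ^ 'n) measure \<Rightarrow> bool" where
  "multivariate_normal m \<Sigma> \<nu> \<longleftrightarrow>
     (\<exists>A :: real ^ 'n ^ 'n. A ** transpose A = \<Sigma> \<and>
        \<nu> = distr std_normal_vec borel (\<lambda>z. m + A *v z))"

text \<open>
  The library's \<^const>\<open>weak_conv_m\<close> is restricted to measures on the real line, hence the
  definition by bounded continuous test functions.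
\<close>

definition converges_in_distribution ::
    "'w measure \<Rightarrow> (nat \<Rightarrow> 'w \<Rightarrow> 'b :: topological_space) \<Rightarrow> 'b measure \<Rightarrow> bool" where
  "converges_in_distribution M Y \<nu> \<longleftrightarrow>
     (\<forall>f :: 'b \<Rightarrow> real. continuous_on UNIV f \<longrightarrow> bounded (range f) \<longrightarrow>
        (\<lambda>N. \<integral>\<omega>. f (Y N \<omega>) \<partial>M) \<longlonglongrightarrow> (\<integral>y. f y \<partial>\<nu>))"

definition small_o_p :: "'w measure \<Rightarrow> (nat \<Rightarrow> 'w \<Rightarrow> real) \<Rightarrow> (nat \<Rightarrow> real) \<Rightarrow> bool" where
  "small_o_p M R a \<longleftrightarrow>
     (\<forall>\<epsilon>>0. (\<lambda>N. measure M {\<omega> \<in> space M. \<bar>R N \<omega> / a N\<bar> > \<epsilon>}) \<longlonglongrightarrow> 0)"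

text \<open>
  A statistic is a function \<open>T A x\<close> of a finite index set \<open>A\<close> and a sample \<open>x\<close> indexed by \<open>A\<close>
  (an element of the extensional product \<open>A \<rightarrow>\<^sub>E space E\<close>). Below, \<open>D N\<close> is the index set of the
  \<open>N\<close>-th subsample; \<open>D N = {1..N}\<close> gives asymptotic linearity along the full sample.
\<close>

definition subsample_statistic ::
    "(nat set \<Rightarrow> (nat \<Rightarrow> 'a) \<Rightarrow> real) \<Rightarrow> (nat \<Rightarrow> 'w \<Rightarrow> 'a) \<Rightarrow> nat set \<Rightarrow> 'w \<Rightarrow> real" where
  "subsample_statistic T X A \<omega> = T A (\<lambda>j\<in>A. X j \<omega>)"

text \<open>
  \<open>X0\<close> is a generic copy of the observations \<open>X j\<close>. Given measurability of \<open>\<psi>\<close>, finiteness of the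
  variance of the centred variable \<open>\<psi> (X0)\<close> is integrability of its square.
\<close>

definition asymptotically_linear ::
    "'w measure \<Rightarrow> 'a measure \<Rightarrow> ('w \<Rightarrow> 'a) \<Rightarrow> (nat \<Rightarrow> 'w \<Rightarrow> 'a) \<Rightarrow> (nat \<Rightarrow> nat set) \<Rightarrow>
     (nat set \<Rightarrow> (nat \<Rightarrow> 'a) \<Rightarrow> real) \<Rightarrow> real \<Rightarrow> ('a \<Rightarrow> real) \<Rightarrow> bool" where
  "asymptotically_linear M E X0 X D T \<theta> \<psi> \<longleftrightarrow>
     \<psi> \<in> borel_measurable E \<and>
     integrable M (\<lambda>\<omega>. \<psi> (X0 \<omega>)) \<and> (\<integral>\<omega>. \<psi> (X0 \<omega>) \<partial>M) = 0 \<and>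
     integrable M (\<lambda>\<omega>. (\<psi> (X0 \<omega>))\<^sup>2) \<and>
     small_o_p M
       (\<lambda>N \<omega>. subsample_statistic T X (D N) \<omega> - \<theta>
               - (1 / real (card (D N))) * (\<Sum>j\<in>D N. \<psi> (X j \<omega>)))
       (\<lambda>N. real (card (D N)) powr (- 1 / 2))"

end

theory Submission
  imports Defs
begin

text \<open>
  Write \<open>S\<^sub>N = L\<^sub>N + R\<^sub>N\<close>, where \<open>L\<^sub>N\<close> has the components \<open>n\<^sub>i\<^sup>-\<^sup>1\<^sup>/\<^sup>2 \<Sum>\<^sub>j\<^sub>\<in>\<^sub>D\<^sub>i \<psi>\<^sub>i(X\<^sub>j)\<close> and \<open>R\<^sub>N \<rightarrow> 0\<close> in
  probability. For fixed \<open>t\<close>, \<open>t \<bullet> L\<^sub>N\<close> is a sum over \<open>j \<le> N\<close> of independent terms \<open>a\<^sub>N\<^sub>j \<bullet> \<psi>(X\<^sub>j)\<close> whose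
  weights have uniformly bounded total square norm and tend to \<open>0\<close> uniformly in \<open>j\<close>; a Lindeberg argument
  for its characteristic function gives the limit \<open>exp (- (t \<bullet> \<Sigma> t) / 2)\<close>, because the covariance of
  components \<open>i\<close> and \<open>k\<close> is the normalised overlap times \<open>E[\<psi>\<^sub>i \<psi>\<^sub>k]\<close>. The remainder does not change
  the limit. Being a limit of covariance matrices, \<open>\<Sigma>\<close> is positive semidefinite, hence of the form
  \<open>A A\<^sup>T\<close>, and the normal law exists. Convergence of characteristic functions is turned into
  convergence of integrals of bounded continuous functions by approximating the latter on large boxes by
  trigonometric polynomials.
\<close>

section \<open>Levy's continuity theorem in Euclidean spaces\<close>

inductive trig_poly :: "('a::euclidean_space \<Rightarrow> complex) \<Rightarrow> bool" where
  monomial: "trig_poly (\<lambda>x. c * iexp (t \<bullet> x))"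
| add: "trig_poly f \<Longrightarrow> trig_poly g \<Longrightarrow> trig_poly (\<lambda>x. f x + g x)"

lemma trig_poly_const: "trig_poly (\<lambda>x. c)"
  using trig_poly.monomial[of c 0] by simp

lemma trig_poly_monomial_mult:
  assumes "trig_poly f"
  shows "trig_poly (\<lambda>x. c * iexp (t \<bullet> x) * f x)"
  using assms
proof (induction rule: trig_poly.induct)
  case (monomial d s)
  have "(\<lambda>x. c * iexp (t \<bullet> x) * (d * iexp (s \<bullet> x))) = (\<lambda>x. (c * d) * iexp ((t + s) \<bullet> x))"
    by (simp add: fun_eq_iff inner_add_left exp_add algebra_simps)
  then show ?case using trig_poly.monomial[of "c * d" "t + s"] by simp
next
  case (add f g)
  from trig_poly.add[OF add.IH] show ?case by (simp add: algebra_simps)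
qed

lemma trig_poly_mult:
  assumes "trig_poly f" "trig_poly g"
  shows "trig_poly (\<lambda>x. f x * g x)"
  using assms(1)
proof (induction rule: trig_poly.induct)
  case (monomial d s)
  show ?case by (rule trig_poly_monomial_mult[OF assms(2)])
next
  case (add f h)
  from trig_poly.add[OF add.IH] show ?case by (simp add: algebra_simps)
qed

lemma trig_poly_sum:
  assumes "finite A" "\<And>i. i \<in> A \<Longrightarrow> trig_poly (f i)"
  shows "trig_poly (\<lambda>x. \<Sum>i\<in>A. f i x)"
  using assms
proof (induction A rule: finite_induct)
  case empty
  then show ?case by (simp add: trig_poly_const)
next
  case (insert a A)
  then have "trig_poly (\<lambda>x. f a x + (\<Sum>i\<in>A. f i x))" by (intro trig_poly.add) auto
  with insert show ?case by simp
qed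

lemma trig_poly_sin: "trig_poly (\<lambda>x. complex_of_real (sin (t \<bullet> x)))"
proof -
  have "complex_of_real (sin (t \<bullet> x)) = (1 / (2 * \<i>)) * iexp (t \<bullet> x) + (- 1 / (2 * \<i>)) * iexp ((- t) \<bullet> x)" for x
    by (simp add: sin_of_real[symmetric] sin_exp_eq field_simps)
  then show ?thesis
    by (simp only:) (intro trig_poly.intros)
qed

text \<open>By induction on how polynomial functions are generated: a linear functional of the
  substituted vector is a linear combination of sines of the coordinates, and sums and products do
  not leave the class.\<close>

lemma trig_poly_real_polynomial_sin:
  fixes p :: "'a::euclidean_space \<Rightarrow> real"
  assumes "real_polynomial_function p"
  shows "trig_poly (\<lambda>x. complex_of_real (p (\<Sum>b\<in>Basis. sin (k * (x \<bullet> b)) *\<^sub>R b)))"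
  using assms
proof (induction rule: real_polynomial_function.induct)
  case (linear f)
  have "trig_poly (\<lambda>x. complex_of_real (sin (k * (x \<bullet> b)) * f b))" for b
    using trig_poly_mult[OF trig_poly_sin[of "k *\<^sub>R b"] trig_poly_const[of "of_real (f b)"]]
    by (simp add: inner_commute)
  then have "trig_poly (\<lambda>x. \<Sum>b\<in>Basis. complex_of_real (sin (k * (x \<bullet> b)) * f b))"
    by (intro trig_poly_sum) auto
  moreover have "f (\<Sum>b\<in>Basis. sin (k * (x \<bullet> b)) *\<^sub>R b) = (\<Sum>b\<in>Basis. sin (k * (x \<bullet> b)) * f b)" for x
    using linear by (simp add: linear_sum[OF bounded_linear.linear] linear_scale[OF bounded_linear.linear])
  ultimately show ?case by simp
next
  case (const c)
  show ?case by (rule trig_poly_const)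
next
  case (add f g)
  then show ?case using trig_poly.add by fastforce
next
  case (mult f g)
  then show ?case using trig_poly_mult by fastforce
qed

lemma integrable_bounded_continuous:
  fixes f :: "'a::topological_space \<Rightarrow> 'b::{banach,second_countable_topology}"
  assumes "prob_space \<kappa>" "sets \<kappa> = sets borel" "continuous_on UNIV f" "\<And>x. norm (f x) \<le> B"
  shows "integrable \<kappa> f"
proof -
  interpret prob_space \<kappa> by fact
  have "f \<in> borel_measurable \<kappa>"
    using borel_measurable_continuous_onI[OF assms(3)] assms(2) by (simp cong: measurable_cong_sets)
  with assms(4) show ?thesis by (intro integrable_const_bound[where B=B]) auto
qed

text \<open>Integrability belongs to the induction claim because the integral of a sum splits only
  for integrable summands.\<close>

lemma trig_poly_integral_tendsto:
  fixes \<mu> :: "nat \<Rightarrow> 'a::euclidean_space measure"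
  assumes "\<And>N. prob_space (\<mu> N)" "\<And>N. sets (\<mu> N) = sets borel"
    and "prob_space \<nu>" "sets \<nu> = sets borel"
    and conv: "\<And>t. (\<lambda>N. CLINT x|\<mu> N. iexp (t \<bullet> x)) \<longlonglongrightarrow> (CLINT x|\<nu>. iexp (t \<bullet> x))"
    and "trig_poly f"
  shows "(\<forall>N. integrable (\<mu> N) f) \<and> integrable \<nu> f \<and>
    (\<lambda>N. integral\<^sup>L (\<mu> N) f) \<longlonglongrightarrow> integral\<^sup>L \<nu> f"
  using assms(6)
proof (induction rule: trig_poly.induct)
  case (monomial c t)
  have i: "integrable \<kappa> (\<lambda>x. c * iexp (t \<bullet> x))" if "prob_space \<kappa>" "sets \<kappa> = sets borel" for \<kappa>
    by (rule integrable_bounded_continuous[OF that, where B="norm c"])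
      (auto intro!: continuous_intros simp: norm_mult)
  show ?case using i[OF assms(1,2)] i[OF assms(3,4)] tendsto_mult[OF tendsto_const[of c] conv[of t]] by simp
next
  case (add f g)
  then show ?case by (auto intro: tendsto_add)
qed

text \<open>A large threshold makes the tail of the limit law small. A continuous function between
  two tail indicators carries this over to the laws \<open>M n\<close>, at the price of enlarging
  the threshold by 1.\<close>

lemma weak_conv_m_imp_tight:
  fixes M :: "nat \<Rightarrow> real measure" and M' :: "real measure"
  assumes "\<And>n. real_distribution (M n)" "real_distribution M'" "weak_conv_m M M'" "0 < e"
  shows "\<exists>K>0. (\<forall>\<^sub>F n in sequentially. measure (M n) {x. K < \<bar>x\<bar>} < e) \<and> measure M' {x. K < \<bar>x\<bar>} < e"
proof -
  interpret M': real_distribution M' by fact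
  have "(\<lambda>n. measure M' {x. real n < \<bar>x\<bar>}) \<longlonglongrightarrow> measure M' (\<Inter>n. {x. real n < \<bar>x\<bar>})"
    by (intro M'.finite_Lim_measure_decseq) (auto simp: decseq_def)
  also have "(\<Inter>n. {x::real. real n < \<bar>x\<bar>}) = {}"
    by auto (metis reals_Archimedean2 less_asym)
  finally have "\<forall>\<^sub>F n in sequentially. measure M' {x. real n < \<bar>x\<bar>} < e"
    using \<open>0 < e\<close> by (intro order_tendstoD(2)) auto
  then obtain k where k: "measure M' {x. real k < \<bar>x\<bar>} < e"
    by (auto simp: eventually_sequentially)
  \<comment> \<open>\<open>h\<close> lies above the indicator of
    \<open>k + 1 < \<bar>x\<bar>\<close> and below that of \<open>k < \<bar>x\<bar>\<close>.\<close>
  define h where "h = (\<lambda>x::real. min 1 (max 0 (\<bar>x\<bar> - real k)))"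
  have h_cont: "isCont h x" for x
    unfolding h_def by (intro continuous_intros)
  have h_bdd: "norm (h x) \<le> 1" for x unfolding h_def by auto
  have h_int: "integrable \<kappa> h" if "real_distribution \<kappa>" for \<kappa>
  proof -
    interpret real_distribution \<kappa> by fact
    show ?thesis
      using h_bdd by (intro integrable_const_bound[where B=1])
        (auto simp: h_def)
  qed
  have lim: "(\<lambda>n. integral\<^sup>L (M n) h) \<longlonglongrightarrow> integral\<^sup>L M' h"
    using assms(1-3) h_cont h_bdd by (rule weak_conv_imp_integral_bdd_continuous_conv)
  have "integral\<^sup>L M' h \<le> (\<integral>x. indicat_real {x. real k < \<bar>x\<bar>} x \<partial>M')"
    by (intro integral_mono h_int assms M'.integrable_const_bound[where B=1])
      (auto simp: h_def indicator_def)
  also have "\<dots> < e" using k by simp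
  finally have "\<forall>\<^sub>F n in sequentially. integral\<^sup>L (M n) h < e"
    using lim by (intro order_tendstoD(2))
  moreover have "measure (M n) {x. real k + 1 < \<bar>x\<bar>} \<le> integral\<^sup>L (M n) h" for n
  proof -
    interpret Mn: real_distribution "M n" by fact
    have "measure (M n) {x. real k + 1 < \<bar>x\<bar>} = (\<integral>x. indicat_real {x. real k + 1 < \<bar>x\<bar>} x \<partial>M n)"
      by simp
    also have "\<dots> \<le> integral\<^sup>L (M n) h"
      by (intro integral_mono h_int assms Mn.integrable_const_bound[where B=1])
        (auto simp: h_def indicator_def)
    finally show ?thesis .
  qed
  ultimately have "\<forall>\<^sub>F n in sequentially. measure (M n) {x. real k + 1 < \<bar>x\<bar>} < e"
    by (auto elim!: eventually_mono intro: le_less_trans)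
  moreover have "measure M' {x. real k + 1 < \<bar>x\<bar>} < e"
    by (rule le_less_trans[OF M'.finite_measure_mono k]) auto
  ultimately show ?thesis by (intro exI[of _ "real k + 1"]) auto
qed

text \<open>The characteristic function of the marginal along \<open>b\<close> at \<open>s\<close>
  is the joint one at \<open>s *\<^sub>R b\<close>. The one-dimensional continuity theorem therefore
  makes every marginal converge, and tightness of the finitely many marginals, each with tail below
  \<open>e / ?d\<close>, gives the claim by a union bound.\<close>

lemma char_tendsto_imp_tight:
  fixes \<mu> :: "nat \<Rightarrow> 'a::euclidean_space measure"
  assumes pm: "\<And>N. prob_space (\<mu> N)" and sm: "\<And>N. sets (\<mu> N) = sets borel"
    and pn: "prob_space \<nu>" and sn: "sets \<nu> = sets borel"
    and conv: "\<And>t. (\<lambda>N. CLINT x|\<mu> N. iexp (t \<bullet> x)) \<longlonglongrightarrow> (CLINT x|\<nu>. iexp (t \<bullet> x))"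
    and "0 < e"
  shows "\<exists>K>0. (\<forall>\<^sub>F n in sequentially. measure (\<mu> n) {x. \<exists>b\<in>Basis. K < \<bar>x \<bullet> b\<bar>} < e)
    \<and> measure \<nu> {x. \<exists>b\<in>Basis. K < \<bar>x \<bullet> b\<bar>} < e"
proof -
  let ?d = "real DIM('a)"
  let ?m = "\<lambda>\<kappa> b. distr \<kappa> borel (\<lambda>x::'a. x \<bullet> b)"
  have meas: "(\<lambda>x::'a. x \<bullet> b) \<in> borel_measurable \<kappa>" if "sets \<kappa> = sets borel" for \<kappa> b
    using that by (simp cong: measurable_cong_sets)
  have rd: "real_distribution (?m \<kappa> b)" if "prob_space \<kappa>" "sets \<kappa> = sets borel" for \<kappa> b
    using that by (intro prob_space.real_distribution_distr meas)
  have ch: "char (?m \<kappa> b) s = (CLINT x|\<kappa>. iexp ((s *\<^sub>R b) \<bullet> x))" if "sets \<kappa> = sets borel" for \<kappa> b s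
    unfolding char_def using meas[OF that, of b] by (subst integral_distr) (auto simp: inner_commute)
  have ms: "measure (?m \<kappa> b) {x. K < \<bar>x\<bar>} = measure \<kappa> {x. K < \<bar>x \<bullet> b\<bar>}" if "sets \<kappa> = sets borel" for \<kappa> b K
    using meas[OF that, of b] sets_eq_imp_space_eq[OF that] by (subst measure_distr) (auto intro!: arg_cong[where f="measure \<kappa>"])
  have weak: "weak_conv_m (\<lambda>n. ?m (\<mu> n) b) (?m \<nu> b)" for b
    by (rule levy_continuity) (simp_all only: rd pm sm pn sn ch conv)
  have "\<exists>K>0. (\<forall>\<^sub>F n in sequentially. measure (?m (\<mu> n) b) {x. K < \<bar>x\<bar>} < e / ?d)
      \<and> measure (?m \<nu> b) {x. K < \<bar>x\<bar>} < e / ?d" for b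
    using \<open>0 < e\<close> by (intro weak_conv_m_imp_tight weak rd pm sm pn sn) auto
  then obtain K where K: "\<And>b. 0 < K b"
    "\<And>b. \<forall>\<^sub>F n in sequentially. measure (\<mu> n) {x. K b < \<bar>x \<bullet> b\<bar>} < e / ?d"
    "\<And>b. measure \<nu> {x. K b < \<bar>x \<bullet> b\<bar>} < e / ?d"
    by (simp only: ms sm sn) metis
  \<comment> \<open>The sum serves as a common upper bound of the positive thresholds
    \<open>K b\<close>.\<close>
  define L where "L = (\<Sum>b\<in>(Basis::'a set). K b)"
  have L: "K b \<le> L" if "b \<in> Basis" for b
    unfolding L_def using that K(1) by (intro member_le_sum) (auto intro: less_imp_le)
  have union: "measure \<kappa> {x. \<exists>b\<in>Basis. L < \<bar>x \<bullet> b\<bar>} < e"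
    if "prob_space \<kappa>" and s: "sets \<kappa> = sets borel"
      and small: "\<And>b. b \<in> Basis \<Longrightarrow> measure \<kappa> {x. K b < \<bar>x \<bullet> b\<bar>} < e / ?d" for \<kappa>
  proof -
    interpret prob_space \<kappa> by fact
    have "measure \<kappa> {x. \<exists>b\<in>Basis. L < \<bar>x \<bullet> b\<bar>} \<le> measure \<kappa> (\<Union>b\<in>Basis. {x. K b < \<bar>x \<bullet> b\<bar>})"
      using L by (intro finite_measure_mono) (auto simp: s intro: le_less_trans)
    also have "\<dots> \<le> (\<Sum>b\<in>Basis. measure \<kappa> {x. K b < \<bar>x \<bullet> b\<bar>})"
      by (intro finite_measure_subadditive_finite) (auto simp: s)
    also have "\<dots> < (\<Sum>b\<in>(Basis::'a set). e / ?d)"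
      using small by (intro sum_strict_mono) auto
    finally show ?thesis by simp
  qed
  have "\<forall>\<^sub>F n in sequentially. \<forall>b\<in>Basis. measure (\<mu> n) {x. K b < \<bar>x \<bullet> b\<bar>} < e / ?d"
    using K(2) by (intro eventually_ball_finite) auto
  then have "\<forall>\<^sub>F n in sequentially. measure (\<mu> n) {x. \<exists>b\<in>Basis. L < \<bar>x \<bullet> b\<bar>} < e"
    by eventually_elim (intro union pm sm, auto)
  moreover have "0 < L"
    unfolding L_def using K(1) by (intro sum_pos) auto
  ultimately show ?thesis using union[OF pn sn K(3)] by blast
qed

text \<open>The substitution \<open>u\<^sub>b = sin (\<pi> x\<^sub>b / 2K)\<close> maps the box of half-width \<open>K\<close> onto the unit cube, so a
  polynomial approximation on the cube becomes a trigonometric one that is bounded on the whole space.\<close>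

lemma trig_poly_approximation:
  fixes f :: "'a::euclidean_space \<Rightarrow> real"
  assumes f: "continuous_on UNIV f" "\<And>x. \<bar>f x\<bar> \<le> B" and "0 < K" "0 < e"
  obtains g where "trig_poly (\<lambda>x. complex_of_real (g x))" "\<And>x. \<bar>g x\<bar> \<le> B + e"
    "\<And>x. (\<And>b. b \<in> Basis \<Longrightarrow> \<bar>x \<bullet> b\<bar> \<le> K) \<Longrightarrow> \<bar>f x - g x\<bar> \<le> e"
proof -
  define Q :: "'a set" where "Q = cbox (- One) One"
  \<comment> \<open>\<open>F\<close> is \<open>f\<close> composed with the inverse of the sine
    substitution, which is continuous on the cube.\<close>
  define F where "F u = f (\<Sum>b\<in>Basis. (2 * K / pi * arcsin (u \<bullet> b)) *\<^sub>R b)" for u :: 'a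
  define s where "s x = (\<Sum>b\<in>Basis. sin ((pi / (2 * K)) * (x \<bullet> b)) *\<^sub>R b)" for x :: 'a
  have s_Q: "s x \<in> Q" for x
    by (auto simp: Q_def mem_box s_def inner_sum_left_Basis)
  have "continuous_on Q F"
    unfolding F_def
    by (intro continuous_on_compose2[OF f(1)] continuous_intros) (auto simp: Q_def mem_box)
  moreover have "compact Q" unfolding Q_def by simp
  ultimately obtain p where p: "real_polynomial_function p" "\<And>u. u \<in> Q \<Longrightarrow> \<bar>F u - p u\<bar> < e"
    using Stone_Weierstrass_real_polynomial_function[OF _ _ \<open>0 < e\<close>] by blast
  show ?thesis
  proof
    show "trig_poly (\<lambda>x. complex_of_real (p (s x)))"
      unfolding s_def by (rule trig_poly_real_polynomial_sin[OF p(1)])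
    \<comment> \<open>This holds on the whole space since \<open>s\<close> takes values in the cube
      only; it controls the approximation where it need not be close to \<open>f\<close>.\<close>
    show "\<bar>p (s x)\<bar> \<le> B + e" for x
    proof -
      have "\<bar>F (s x) - p (s x)\<bar> < e" by (rule p(2)[OF s_Q])
      moreover have "\<bar>F (s x)\<bar> \<le> B" unfolding F_def by (rule f(2))
      ultimately show ?thesis by linarith
    qed
    show "\<bar>f x - p (s x)\<bar> \<le> e" if x: "\<And>b. b \<in> Basis \<Longrightarrow> \<bar>x \<bullet> b\<bar> \<le> K" for x
    proof -
      \<comment> \<open>On the box the argument of the sine lies between \<open>- pi / 2\<close> and
        \<open>pi / 2\<close>, where \<open>arcsin\<close> inverts \<open>sin\<close>.\<close>
      have "2 * K / pi * arcsin (s x \<bullet> b) = x \<bullet> b" if b: "b \<in> Basis" for b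
      proof -
        have "- K \<le> x \<bullet> b" "x \<bullet> b \<le> K" using x[OF b] by linarith+
        then have "- (pi / 2) \<le> (pi / (2 * K)) * (x \<bullet> b)" "(pi / (2 * K)) * (x \<bullet> b) \<le> pi / 2"
          using \<open>0 < K\<close> mult_left_mono[of "- K" "x \<bullet> b" pi] mult_left_mono[of "x \<bullet> b" K pi]
          by (simp_all add: field_simps)
        then have "arcsin (sin ((pi / (2 * K)) * (x \<bullet> b))) = (pi / (2 * K)) * (x \<bullet> b)"
          by (intro arcsin_sin) auto
        then show ?thesis using b \<open>0 < K\<close> by (simp add: s_def inner_sum_left_Basis)
      qed
      then have "F (s x) = f x" unfolding F_def by (simp add: euclidean_representation)
      with p(2)[OF s_Q, of x] show ?thesis by simp
    qed
  qed
qed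

text \<open>\<open>f\<close> is replaced by a trigonometric polynomial \<open>g\<close>, whose
  integrals converge. Under each of the laws this costs \<open>d\<close> on the box and at most
  \<open>2 * B + d\<close> outside, a set of mass below \<open>d\<close> for the limit and
  eventually for the sequence.\<close>

theorem levy_continuity_euclidean:
  fixes \<mu> :: "nat \<Rightarrow> 'a::euclidean_space measure" and f :: "'a \<Rightarrow> real"
  assumes pm: "\<And>N. prob_space (\<mu> N)" and sm: "\<And>N. sets (\<mu> N) = sets borel"
    and pn: "prob_space \<nu>" and sn: "sets \<nu> = sets borel"
    and conv: "\<And>t. (\<lambda>N. CLINT x|\<mu> N. iexp (t \<bullet> x)) \<longlonglongrightarrow> (CLINT x|\<nu>. iexp (t \<bullet> x))"
    and f: "continuous_on UNIV f" "bounded (range f)"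
  shows "(\<lambda>N. integral\<^sup>L (\<mu> N) f) \<longlonglongrightarrow> integral\<^sup>L \<nu> f"
proof (rule LIMSEQ_I)
  fix e :: real assume "0 < e"
  obtain B where B: "\<And>x. \<bar>f x\<bar> \<le> B" using f(2) by (auto simp: bounded_iff)
  have "0 \<le> B" using B[of undefined] by linarith
  \<comment> \<open>\<open>4 * B + 6\<close> collects two approximation errors
    \<open>d * (2 * B + 2)\<close> and an allowance \<open>2 * d\<close> for the integrals of
    \<open>g\<close>; the bound \<open>d \<le> 1\<close> absorbs the quadratic term in
    \<open>d\<close>.\<close>
  define d where "d = min 1 (e / (4 * B + 6))"
  have d: "0 < d" "d \<le> 1" "d * (4 * B + 6) \<le> e"
    using \<open>0 < e\<close> \<open>0 \<le> B\<close> by (simp_all add: d_def flip: pos_le_divide_eq)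
  obtain K where K: "0 < K"
    "\<forall>\<^sub>F n in sequentially. measure (\<mu> n) {x. \<exists>b\<in>Basis. K < \<bar>x \<bullet> b\<bar>} < d"
    "measure \<nu> {x. \<exists>b\<in>Basis. K < \<bar>x \<bullet> b\<bar>} < d"
    using char_tendsto_imp_tight[OF pm sm pn sn conv d(1)] by blast
  obtain g where g: "trig_poly (\<lambda>x. complex_of_real (g x))" "\<And>x. \<bar>g x\<bar> \<le> B + d"
    "\<And>x. (\<And>b. b \<in> Basis \<Longrightarrow> \<bar>x \<bullet> b\<bar> \<le> K) \<Longrightarrow> \<bar>f x - g x\<bar> \<le> d"
    using trig_poly_approximation[OF f(1) B K(1) d(1)] by blast
  note gt = trig_poly_integral_tendsto[OF pm sm pn sn conv g(1)]
  have int_g: "integrable (\<mu> N) g" "integrable \<nu> g" for N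
    using gt by (simp_all only: complex_of_real_integrable_eq)
  have approx: "\<bar>integral\<^sup>L \<kappa> f - integral\<^sup>L \<kappa> g\<bar> \<le> d * (2 * B + 2)"
    if pk: "prob_space \<kappa>" and sk: "sets \<kappa> = sets borel" and ig: "integrable \<kappa> g"
      and small: "measure \<kappa> {x. \<exists>b\<in>Basis. K < \<bar>x \<bullet> b\<bar>} < d" for \<kappa>
  proof -
    interpret prob_space \<kappa> by fact
    let ?A = "{x::'a. \<exists>b\<in>Basis. K < \<bar>x \<bullet> b\<bar>}"
    have [measurable]: "?A \<in> sets \<kappa>" by (simp add: sk)
    have ind: "integrable \<kappa> (indicat_real ?A)"
      by (intro integrable_const_bound[where B=1]) auto
    have one: "measure \<kappa> UNIV = 1"
      using prob_space sets_eq_imp_space_eq[OF sk] by simp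
    have if': "integrable \<kappa> f"
      using B by (intro integrable_bounded_continuous[OF pk sk f(1)]) auto
    have "\<bar>integral\<^sup>L \<kappa> f - integral\<^sup>L \<kappa> g\<bar> = \<bar>\<integral>x. f x - g x \<partial>\<kappa>\<bar>"
      using if' ig by simp
    also have "\<dots> \<le> (\<integral>x. \<bar>f x - g x\<bar> \<partial>\<kappa>)" by (rule integral_abs_bound)
    also have "\<dots> \<le> (\<integral>x. d + (2 * B + d) * indicator ?A x \<partial>\<kappa>)"
    proof (intro integral_mono)
      show "integrable \<kappa> (\<lambda>x. d + (2 * B + d) * indicator ?A x)"
        using ind by simp
      show "\<bar>f x - g x\<bar> \<le> d + (2 * B + d) * indicator ?A x" for x
        using B[of x] g(2)[of x] g(3)[of x] d by (cases "x \<in> ?A") (auto simp: not_less)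
    qed (use if' ig in auto)
    also have "\<dots> = d + (2 * B + d) * measure \<kappa> ?A"
      using ind one by (simp add: sets_eq_imp_space_eq[OF sk])
    also have "\<dots> \<le> d + (2 * B + d) * d"
      using small d \<open>0 \<le> B\<close> by (intro add_mono mult_left_mono) auto
    also have "\<dots> \<le> d + (2 * B + 1) * d"
      using d \<open>0 \<le> B\<close> by (intro add_mono mult_right_mono) auto
    finally show ?thesis by (simp add: algebra_simps)
  qed
  have "(\<lambda>N. complex_of_real (integral\<^sup>L (\<mu> N) g)) \<longlonglongrightarrow> complex_of_real (integral\<^sup>L \<nu> g)"
    using gt by simp
  then have "(\<lambda>N. integral\<^sup>L (\<mu> N) g) \<longlonglongrightarrow> integral\<^sup>L \<nu> g"
    by (simp only: tendsto_of_real_iff)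
  then have "\<forall>\<^sub>F N in sequentially. \<bar>integral\<^sup>L (\<mu> N) g - integral\<^sup>L \<nu> g\<bar> < d"
    using tendstoD[OF _ d(1), of _ "integral\<^sup>L \<nu> g"] by (simp add: dist_real_def)
  with K(2) have "\<forall>\<^sub>F N in sequentially. norm (integral\<^sup>L (\<mu> N) f - integral\<^sup>L \<nu> f) < e"
  proof eventually_elim
    case (elim N)
    have "\<bar>integral\<^sup>L (\<mu> N) f - integral\<^sup>L \<nu> f\<bar> < 2 * (d * (2 * B + 2)) + 2 * d"
      using approx[OF pm sm int_g(1) elim(1)] approx[OF pn sn int_g(2) K(3)] elim(2) d(1) by linarith
    also have "\<dots> = d * (4 * B + 6)" by (simp add: algebra_simps)
    also have "\<dots> \<le> e" by (rule d(3))
    finally show ?case by simp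
  qed
  then show "\<exists>no. \<forall>N\<ge>no. norm (integral\<^sup>L (\<mu> N) f - integral\<^sup>L \<nu> f) < e"
    by (simp add: eventually_sequentially)
qed

section \<open>Multivariate normal laws\<close>

lemma prod_Basis_vec:
  fixes g :: "real ^ 'n \<Rightarrow> 'b::comm_monoid_mult"
  shows "(\<Prod>b\<in>Basis. g b) = (\<Prod>i\<in>UNIV. g (axis i 1))"
proof -
  have basis: "(Basis :: (real ^ 'n) set) = range (\<lambda>i. axis i 1)"
    by (auto simp: Basis_vec_def)
  have inj: "inj (\<lambda>i. axis i 1 :: real ^ 'n)"
    by (auto simp: inj_def axis_eq_axis)
  show ?thesis
    unfolding basis prod.reindex[OF inj] comp_def ..
qed

text \<open>Fubini: Lebesgue measure is the image of a product measure indexed by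
  \<open>Basis\<close>, so the coordinates are first relabelled by basis vectors; \<open>ix\<close>
  recovers the index.\<close>

lemma integral_lborel_vec_prod:
  fixes f :: "'n::finite \<Rightarrow> real \<Rightarrow> 'b::{real_normed_field,banach,second_countable_topology}"
  assumes "\<And>i. integrable lborel (f i)"
  shows "(\<integral>x. (\<Prod>i\<in>UNIV. f i ((x :: real ^ 'n) $ i)) \<partial>lborel) = (\<Prod>i\<in>UNIV. integral\<^sup>L lborel (f i))"
proof -
  interpret product_sigma_finite "\<lambda>_::real ^ 'n. lborel :: real measure" ..
  define ix where "ix = the_inv (\<lambda>i::'n. axis i (1::real))"
  have ix: "ix (axis i 1) = i" for i
    unfolding ix_def by (rule the_inv_f_f) (auto simp: inj_def axis_eq_axis)
  have [measurable]: "f i \<in> borel_measurable borel" for i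
    using borel_measurable_integrable[OF assms[of i]] by simp
  have "(\<integral>x. (\<Prod>i\<in>UNIV. f i ((x :: real ^ 'n) $ i)) \<partial>lborel)
      = (\<integral>x. (\<Prod>b\<in>Basis. f (ix b) ((x :: real ^ 'n) \<bullet> b)) \<partial>lborel)"
    by (simp add: prod_Basis_vec ix inner_axis)
  also have "\<dots> = (\<integral>x. (\<Prod>b\<in>Basis. f (ix b) (x b)) \<partial>(\<Pi>\<^sub>M b\<in>(Basis::(real ^ 'n) set). lborel))"
    by (subst lborel_eq, subst integral_distr) (auto intro!: Bochner_Integration.integral_cong prod.cong simp: inner_sum_left_Basis)
  also have "\<dots> = (\<Prod>b\<in>(Basis::(real ^ 'n) set). integral\<^sup>L lborel (f (ix b)))"
    by (rule product_integral_prod) (auto intro: assms)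
  finally show ?thesis by (simp add: prod_Basis_vec ix)
qed

lemma sets_std_normal_vec [measurable_cong]: "sets std_normal_vec = sets borel"
  by (simp add: std_normal_vec_def)

lemma measurable_std_normal_vec_density [measurable]:
  "(\<lambda>x::real ^ 'n. \<Prod>i\<in>UNIV. std_normal_density (x $ i)) \<in> borel_measurable borel"
proof (intro borel_measurable_prod)
  fix i :: 'n
  have "(\<lambda>x::real ^ 'n. x $ i) \<in> borel_measurable borel"
    by (intro borel_measurable_continuous_onI continuous_intros)
  then show "(\<lambda>x::real ^ 'n. std_normal_density (x $ i)) \<in> borel_measurable borel"
    by (rule measurable_compose) simp
qed

lemma prob_space_std_normal_vec: "prob_space (std_normal_vec :: (real ^ 'n) measure)"
proof -
  let ?d = "\<lambda>x::real ^ 'n. \<Prod>i\<in>UNIV. std_normal_density (x $ i)"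
  have "(\<integral>x. ?d x \<partial>lborel) = 1"
    by (subst integral_lborel_vec_prod) simp_all
  \<comment> \<open>The Bochner integral of a non-integrable function is 0, so the value 1 already
    implies integrability.\<close>
  moreover from this have "integrable lborel ?d"
    using not_integrable_integral_eq by fastforce
  ultimately have "(\<integral>\<^sup>+ x. ennreal (?d x) \<partial>lborel) = 1"
    by (subst nn_integral_eq_integral) (auto intro!: AE_I2 prod_nonneg)
  then show ?thesis
    by (intro prob_spaceI) (simp add: std_normal_vec_def emeasure_density)
qed

text \<open>Density and exponential both factor over the coordinates, which leaves one-dimensional
  normal characteristic functions.\<close>

lemma char_std_normal_vec:
  "(CLINT z|std_normal_vec. iexp (u \<bullet> (z :: real ^ 'n))) = complex_of_real (exp (- (u \<bullet> u) / 2))"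
proof -
  let ?d = "\<lambda>x::real ^ 'n. \<Prod>i\<in>UNIV. std_normal_density (x $ i)"
  have one: "integrable lborel (\<lambda>x. std_normal_density x *\<^sub>R iexp (s * x))"
    "(\<integral>x. std_normal_density x *\<^sub>R iexp (s * x) \<partial>lborel) = complex_of_real (exp (- (s\<^sup>2) / 2))" for s
  proof -
    interpret real_distribution std_normal_distribution by (rule real_dist_normal_dist)
    have "integrable std_normal_distribution (\<lambda>x. iexp (s * x))"
      using integrable_iexp[of "\<lambda>x. complex_of_real (s * x)"] by simp
    then show "integrable lborel (\<lambda>x. std_normal_density x *\<^sub>R iexp (s * x))"
      by (subst (asm) integrable_density) auto
    show "(\<integral>x. std_normal_density x *\<^sub>R iexp (s * x) \<partial>lborel) = complex_of_real (exp (- (s\<^sup>2) / 2))"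
      using fun_cong[OF char_std_normal_distribution, of s] unfolding char_def
      by (subst (asm) integral_density) auto
  qed
  have "(CLINT z|std_normal_vec. iexp (u \<bullet> (z :: real ^ 'n))) = (\<integral>z. ?d z *\<^sub>R iexp (u \<bullet> z) \<partial>lborel)"
    unfolding std_normal_vec_def by (subst integral_density) (auto intro!: AE_I2 prod_nonneg)
  also have "\<dots> = (\<integral>z. (\<Prod>i\<in>UNIV. std_normal_density (z $ i) *\<^sub>R iexp (u $ i * z $ i)) \<partial>lborel)"
    by (simp add: scaleR_conv_of_real inner_vec_def exp_sum sum_distrib_left prod.distrib)
  also have "\<dots> = (\<Prod>i\<in>UNIV. complex_of_real (exp (- ((u $ i)\<^sup>2) / 2)))"
    using one by (subst integral_lborel_vec_prod) simp_all
  also have "\<dots> = complex_of_real (exp (- (u \<bullet> u) / 2))"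
    by (simp only: of_real_prod[symmetric] exp_sum[symmetric] finite) 
      (simp add: inner_vec_def power2_eq_square sum_negf sum_divide_distrib)
  finally show ?thesis .
qed

text \<open>Transposition moves \<open>A\<close> to the argument: the standard normal characteristic
  function is evaluated at \<open>transpose A *v t\<close>, whose squared norm is the quadratic form
  of \<open>\<Sigma>\<close>. The summand 0 matches the mean in
  \<open>multivariate_normal\<close>.\<close>

lemma char_affine_std_normal_vec:
  fixes A :: "real ^ 'n ^ 'n"
  assumes "A ** transpose A = \<Sigma>"
  shows "(CLINT x|distr std_normal_vec borel (\<lambda>z. 0 + A *v z). iexp (t \<bullet> x))
    = complex_of_real (exp (- (t \<bullet> (\<Sigma> *v t)) / 2))"
proof -
  have [measurable]: "(\<lambda>z. A *v z) \<in> borel_measurable borel"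
    by (intro borel_measurable_continuous_onI linear_continuous_on bounded_linear_intros) simp
  have "t \<bullet> (\<Sigma> *v t) = (transpose A *v t) \<bullet> (transpose A *v t)"
    unfolding assms[symmetric]
    by (simp add: matrix_vector_mul_assoc[symmetric] dot_lmul_matrix[symmetric])
  moreover have "t \<bullet> (A *v z) = (transpose A *v t) \<bullet> z" for z
    by (simp add: dot_lmul_matrix[symmetric])
  ultimately show ?thesis
    by (subst integral_distr) (simp_all add: char_std_normal_vec)
qed

text \<open>Cholesky factorisation; if the pivot \<open>q k k\<close> vanishes then so does its row, and the convention
  \<open>x / 0 = 0\<close> makes the formulas for the Schur complement valid in this case too.\<close>

lemma psd_imp_gram_on:
  fixes q :: "'n \<Rightarrow> 'n \<Rightarrow> real"
  assumes "finite I" "\<And>i j. q i j = q j i"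
    and "\<And>x. 0 \<le> (\<Sum>i\<in>I. \<Sum>j\<in>I. q i j * x i * x j)"
  shows "\<exists>v :: 'n \<Rightarrow> 'n \<Rightarrow> real. \<forall>i\<in>I. \<forall>j\<in>I. (\<Sum>l\<in>I. v i l * v j l) = q i j"
  using assms
proof (induction I arbitrary: q rule: finite_induct)
  case empty
  then show ?case by simp
next
  case (insert k I)
  let ?S = "\<lambda>x. \<Sum>i\<in>I. \<Sum>j\<in>I. q i j * x i * x j"
  let ?L = "\<lambda>x. \<Sum>i\<in>I. q k i * x i"
  have expand: "(\<Sum>i\<in>insert k I. \<Sum>j\<in>insert k I. q i j * x i * x j)
      = q k k * (x k)\<^sup>2 + 2 * x k * ?L x + ?S x" for x
  proof -
    have "(\<Sum>i\<in>I. q i k * x i * x k) = x k * ?L x" "(\<Sum>j\<in>I. q k j * x k * x j) = x k * ?L x"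
      by (simp_all add: sum_distrib_left insert.prems(1)[of k] mult_ac)
    then show ?thesis
      using insert.hyps by (simp add: sum.distrib power2_eq_square algebra_simps)
  qed
  \<comment> \<open>As \<open>k\<close> is not in \<open>I\<close>, changing \<open>x\<close> at
    \<open>k\<close> alone leaves both sums fixed, so the value \<open>y\<close> there is
    free.\<close>
  have psd: "0 \<le> q k k * y\<^sup>2 + 2 * y * ?L x + ?S x" for x y
  proof -
    have "?L (x(k := y)) = ?L x" "?S (x(k := y)) = ?S x"
      using insert.hyps by (auto intro!: sum.cong)
    then show ?thesis
      using insert.prems(2)[of "x(k := y)"] unfolding expand by simp
  qed
  have "0 \<le> q k k" using psd[of 1 "\<lambda>_. 0"] by simp
  have zero: "q k i = 0" if "q k k = 0" "i \<in> I" for i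
  proof (rule ccontr)
    assume "q k i \<noteq> 0"
    let ?x = "\<lambda>j. if j = i then 1 else 0::real"
    have "?L ?x = (\<Sum>j\<in>I. if j = i then q k j else 0)" by (intro sum.cong) auto
    then have "?L ?x = q k i" using insert.hyps that by simp
    then have "0 \<le> 2 * y * q k i + ?S ?x" for y
      using psd[of y ?x] that by simp
    \<comment> \<open>With this \<open>y\<close> the right-hand side equals -1.\<close>
    from this[of "- (?S ?x + 1) / (2 * q k i)"] \<open>q k i \<noteq> 0\<close> show False
      by (simp add: field_simps)
  qed
  define q' where "q' i j = q i j - q k i * q k j / q k k" for i j
  have "\<exists>v :: 'n \<Rightarrow> 'n \<Rightarrow> real. \<forall>i\<in>I. \<forall>j\<in>I. (\<Sum>l\<in>I. v i l * v j l) = q' i j"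
  proof (rule insert.IH)
    show "q' i j = q' j i" for i j
      by (simp add: q'_def insert.prems(1)[of i j])
    show "0 \<le> (\<Sum>i\<in>I. \<Sum>j\<in>I. q' i j * x i * x j)" for x
    proof -
      have "(\<Sum>i\<in>I. \<Sum>j\<in>I. q' i j * x i * x j) = ?S x - (?L x)\<^sup>2 / q k k"
        by (simp add: q'_def left_diff_distrib right_diff_distrib sum_subtractf power2_eq_square sum_product
            sum_divide_distrib mult_ac)
      \<comment> \<open>For a positive pivot this is the full form at its minimiser in the
        coordinate \<open>k\<close>.\<close>
      also have "\<dots> = q k k * (- ?L x / q k k)\<^sup>2 + 2 * (- ?L x / q k k) * ?L x + ?S x"
        by (cases "q k k = 0") (simp_all add: field_simps power2_eq_square)
      finally show ?thesis using psd[of "- ?L x / q k k" x] by simp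
    qed
  qed
  then obtain v where v: "\<And>i j. i \<in> I \<Longrightarrow> j \<in> I \<Longrightarrow> (\<Sum>l\<in>I. v i l * v j l) = q' i j"
    by blast
  \<comment> \<open>The new column \<open>k\<close> holds the root of the pivot and the scaled row
    of \<open>q\<close>; the remaining columns come from the factor of the Schur complement, with
    zeros in row \<open>k\<close>.\<close>
  define w where "w i l = (if l = k then (if i = k then sqrt (q k k) else q k i / sqrt (q k k))
    else if i = k then 0 else v i l)" for i l
  have "(\<Sum>l\<in>insert k I. w i l * w j l) = q i j" if "i \<in> insert k I" "j \<in> insert k I" for i j
  proof -
    have "(\<Sum>l\<in>insert k I. w i l * w j l) = w i k * w j k + (\<Sum>l\<in>I. w i l * w j l)"
      using insert.hyps by simp
    also have "(\<Sum>l\<in>I. w i l * w j l) = (if i = k \<or> j = k then 0 else q' i j)"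
    proof -
      have "(\<Sum>l\<in>I. w i l * w j l) = (\<Sum>l\<in>I. if i = k \<or> j = k then 0 else v i l * v j l)"
        using insert.hyps by (intro sum.cong) (auto simp: w_def)
      then show ?thesis using v[of i j] that by auto
    qed
    finally show ?thesis
      using that insert.hyps(2) zero \<open>0 \<le> q k k\<close> insert.prems(1)[of i k]
      by (auto simp: w_def q'_def real_div_sqrt field_simps)
  qed
  then show ?case by blast
qed

lemma psd_imp_matrix_square_root:
  fixes \<Sigma> :: "real ^ 'n ^ 'n"
  assumes "\<And>i j. \<Sigma> $ i $ j = \<Sigma> $ j $ i" "\<And>t. 0 \<le> t \<bullet> (\<Sigma> *v t)"
  obtains A :: "real ^ 'n ^ 'n" where "A ** transpose A = \<Sigma>"
proof -
  have "0 \<le> (\<Sum>i\<in>UNIV. \<Sum>j\<in>UNIV. \<Sigma> $ i $ j * x i * x j)" for x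
    using assms(2)[of "\<chi> i. x i"]
    by (simp add: inner_vec_def matrix_vector_mult_def sum_distrib_left mult_ac)
  from psd_imp_gram_on[OF finite assms(1) this]
  obtain v :: "'n \<Rightarrow> 'n \<Rightarrow> real" where "\<And>i j. (\<Sum>l\<in>UNIV. v i l * v j l) = \<Sigma> $ i $ j"
    by auto
  then have "(\<chi> i l. v i l) ** transpose (\<chi> i l. v i l) = \<Sigma>"
    by (simp add: vec_eq_iff matrix_matrix_mult_def transpose_def)
  then show ?thesis by (rule that)
qed

section \<open>Weighted sums of independent identically distributed vectors\<close>

text \<open>The lower estimate is the tangent line. The upper one follows from
  \<open>(1 - x + x\<^sup>2) * (1 + x) = 1 + x ^ 3\<close> and
  \<open>1 + x \<le> exp x\<close>.\<close>

lemma exp_minus_approx: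
  fixes x :: real
  assumes "0 \<le> x"
  shows "\<bar>exp (- x) - (1 - x)\<bar> \<le> x\<^sup>2"
proof -
  have "1 - x \<le> exp (- x)" using exp_ge_add_one_self[of "- x"] by simp
  moreover have "exp (- x) \<le> 1 - x + x\<^sup>2"
  proof -
    have "1 \<le> 1 + x ^ 3" using assms by simp
    also have "\<dots> = (1 - x + x\<^sup>2) * (1 + x)" by (simp add: algebra_simps power2_eq_square power3_eq_cube)
    also have "\<dots> \<le> (1 - x + x\<^sup>2) * exp x"
    proof (intro mult_left_mono)
      have "0 \<le> (x - 1)\<^sup>2 + x" using assms by simp
      then show "0 \<le> 1 - x + x\<^sup>2" by (simp add: power2_eq_square algebra_simps)
    qed (rule exp_ge_add_one_self)
    finally show ?thesis by (simp add: exp_minus field_simps)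
  qed
  ultimately show ?thesis by simp
qed

text \<open>Cauchy-Schwarz in both branches of the minimum. In the cubic branch one of the three
  factors \<open>norm a\<close> is bounded by \<open>sqrt m\<close>, so that both branches carry
  \<open>(norm a)\<^sup>2\<close>.\<close>

lemma inner_lindeberg_bound:
  fixes a v :: "'b::euclidean_space"
  assumes "(norm a)\<^sup>2 \<le> m"
  shows "min (6 * (a \<bullet> v)\<^sup>2) (\<bar>a \<bullet> v\<bar> ^ 3) \<le> (norm a)\<^sup>2 * min (6 * (norm v)\<^sup>2) (sqrt m * norm v ^ 3)"
proof -
  have "norm a \<le> sqrt m" using assms by (rule real_le_rsqrt)
  have cs: "\<bar>a \<bullet> v\<bar> \<le> norm a * norm v" by (rule Cauchy_Schwarz_ineq2)
  have "(a \<bullet> v)\<^sup>2 \<le> (norm a * norm v)\<^sup>2"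
    using power_mono[OF cs abs_ge_zero, of 2] by simp
  then have 1: "6 * (a \<bullet> v)\<^sup>2 \<le> (norm a)\<^sup>2 * (6 * (norm v)\<^sup>2)"
    by (simp add: power_mult_distrib)
  have "\<bar>a \<bullet> v\<bar> ^ 3 \<le> (norm a * norm v) ^ 3" by (intro power_mono cs) simp
  also have "\<dots> = (norm a)\<^sup>2 * (norm a * norm v ^ 3)"
    by (simp add: power2_eq_square power3_eq_cube)
  also have "\<dots> \<le> (norm a)\<^sup>2 * (sqrt m * norm v ^ 3)"
    using \<open>norm a \<le> sqrt m\<close> by (intro mult_left_mono mult_right_mono) auto
  finally have 2: "\<bar>a \<bullet> v\<bar> ^ 3 \<le> (norm a)\<^sup>2 * (sqrt m * norm v ^ 3)" .
  show ?thesis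
  proof (cases "6 * (norm v)\<^sup>2 \<le> sqrt m * norm v ^ 3")
    case True
    then show ?thesis using min.coboundedI1[OF 1] by (simp only: min_absorb1)
  next
    case False
    then show ?thesis using min.coboundedI2[OF 2] by (simp only: min_absorb2 linear not_le less_imp_le)
  qed
qed

context prob_space
begin

text \<open>The error factors into \<open>(norm a)\<^sup>2\<close> and a term depending on \<open>a\<close> only through \<open>m\<close>, so that in a sum of
  independent terms the square norms of the weights add up.\<close>

lemma char_inner_approx:
  fixes V :: "'a \<Rightarrow> 'b::euclidean_space"
  assumes V [measurable]: "random_variable borel V"
    and sq: "integrable M (\<lambda>\<omega>. (norm (V \<omega>))\<^sup>2)"
    and mean: "\<And>a. expectation (\<lambda>\<omega>. a \<bullet> V \<omega>) = 0"
    and a: "(norm a)\<^sup>2 \<le> m"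
  shows "cmod (char (distr M borel (\<lambda>\<omega>. a \<bullet> V \<omega>)) 1 - complex_of_real (exp (- expectation (\<lambda>\<omega>. (a \<bullet> V \<omega>)\<^sup>2) / 2)))
    \<le> (norm a)\<^sup>2 * (expectation (\<lambda>\<omega>. min (6 * (norm (V \<omega>))\<^sup>2) (sqrt m * norm (V \<omega>) ^ 3)) / 6
        + m * (expectation (\<lambda>\<omega>. (norm (V \<omega>))\<^sup>2))\<^sup>2)"
proof -
  let ?s = "expectation (\<lambda>\<omega>. (a \<bullet> V \<omega>)\<^sup>2)"
  let ?c = "expectation (\<lambda>\<omega>. (norm (V \<omega>))\<^sup>2)"
  let ?w = "(norm a)\<^sup>2"
  have "0 \<le> m" using a zero_le_power2[of "norm a"] by linarith
  have le: "(a \<bullet> v)\<^sup>2 \<le> ?w * (norm v)\<^sup>2" for v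
    using power_mono[OF Cauchy_Schwarz_ineq2[of a v] abs_ge_zero, of 2] by (simp add: power_mult_distrib)
  have int2: "integrable M (\<lambda>\<omega>. (a \<bullet> V \<omega>)\<^sup>2)"
    by (rule Bochner_Integration.integrable_bound[OF integrable_mult_right[OF sq, of ?w]]) (auto simp: le)
  have int1: "integrable M (\<lambda>\<omega>. a \<bullet> V \<omega>)"
    by (rule square_integrable_imp_integrable[OF _ int2]) simp
  have intm: "integrable M (\<lambda>\<omega>. min (6 * (norm (V \<omega>))\<^sup>2) (sqrt m * norm (V \<omega>) ^ 3))"
    by (rule Bochner_Integration.integrable_bound[OF integrable_mult_right[OF sq, of 6]])
      (use \<open>0 \<le> m\<close> in auto)
  have intz: "integrable M (\<lambda>\<omega>. min (6 * (a \<bullet> V \<omega>)\<^sup>2) (\<bar>a \<bullet> V \<omega>\<bar> ^ 3))"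
    by (rule Bochner_Integration.integrable_bound[OF integrable_mult_right[OF int2, of 6]]) auto
  \<comment> \<open>Second-order expansion of the characteristic function at 1, with the Lindeberg
    form of the error, which needs second moments only.\<close>
  have "cmod (char (distr M borel (\<lambda>\<omega>. a \<bullet> V \<omega>)) 1 - (1 - 1\<^sup>2 * ?s / 2))
      \<le> (1\<^sup>2 / 6) * expectation (\<lambda>\<omega>. min (6 * (a \<bullet> V \<omega>)\<^sup>2) (\<bar>1\<bar> * \<bar>a \<bullet> V \<omega>\<bar> ^ 3))"
    by (rule char_approx3') (auto simp: int1 int2 mean)
  also have "\<dots> \<le> (1\<^sup>2 / 6) * expectation (\<lambda>\<omega>. ?w * min (6 * (norm (V \<omega>))\<^sup>2) (sqrt m * norm (V \<omega>) ^ 3))"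
    using intm intz inner_lindeberg_bound[OF a]
    by (intro mult_left_mono integral_mono) (auto simp del: mult_minus_right)
  finally have 1: "cmod (char (distr M borel (\<lambda>\<omega>. a \<bullet> V \<omega>)) 1 - complex_of_real (1 - ?s / 2))
      \<le> ?w * (expectation (\<lambda>\<omega>. min (6 * (norm (V \<omega>))\<^sup>2) (sqrt m * norm (V \<omega>) ^ 3)) / 6)"
    using intm by simp
  have "0 \<le> ?s" by simp
  have "?s \<le> expectation (\<lambda>\<omega>. ?w * (norm (V \<omega>))\<^sup>2)"
    using int2 sq le by (intro integral_mono) auto
  then have "?s \<le> ?w * ?c" by simp
  \<comment> \<open>Passing from \<open>1 - ?s / 2\<close> to the exponential costs a term quadratic
    in \<open>?s\<close>; one factor \<open>(norm a)\<^sup>2\<close> of it is bounded by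
    \<open>m\<close>.\<close>
  have "cmod (complex_of_real (1 - ?s / 2) - complex_of_real (exp (- ?s / 2))) = \<bar>exp (- (?s / 2)) - (1 - ?s / 2)\<bar>"
    by (simp only: of_real_diff[symmetric] norm_of_real abs_minus_commute) simp
  also have "\<dots> \<le> (?s / 2)\<^sup>2" using \<open>0 \<le> ?s\<close> by (intro exp_minus_approx) simp
  also have "\<dots> \<le> ?s\<^sup>2" by (simp add: power_divide)
  also have "\<dots> \<le> (?w * ?c)\<^sup>2" using \<open>0 \<le> ?s\<close> \<open>?s \<le> ?w * ?c\<close> by (intro power_mono)
  also have "\<dots> = ?w * (?w * ?c\<^sup>2)" by (simp add: power2_eq_square)
  also have "\<dots> \<le> ?w * (m * ?c\<^sup>2)" using a by (intro mult_left_mono mult_right_mono) auto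
  finally have 2: "cmod (complex_of_real (1 - ?s / 2) - complex_of_real (exp (- ?s / 2))) \<le> ?w * (m * ?c\<^sup>2)" .
  have "?w * (expectation (\<lambda>\<omega>. min (6 * (norm (V \<omega>))\<^sup>2) (sqrt m * norm (V \<omega>) ^ 3)) / 6 + m * ?c\<^sup>2)
      = ?w * (expectation (\<lambda>\<omega>. min (6 * (norm (V \<omega>))\<^sup>2) (sqrt m * norm (V \<omega>) ^ 3)) / 6) + ?w * (m * ?c\<^sup>2)"
    by (simp add: distrib_left)
  then show ?thesis
    using norm_triangle_le[OF add_mono[OF 1 2]] by simp
qed

text \<open>Independence turns the characteristic function into a product. Its factors and the
  Gaussian ones have modulus at most 1, so the products differ by at most the sum of the single
  errors, hence by \<open>B\<close> times a quantity that vanishes with \<open>m N\<close>.\<close>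

theorem char_weighted_iid_sum_tendsto:
  fixes V :: "'i \<Rightarrow> 'a \<Rightarrow> 'b::euclidean_space"
  assumes indep: "indep_vars (\<lambda>_. borel) V I"
    and distr: "\<And>j. j \<in> I \<Longrightarrow> distr M borel (V j) = distr M borel V0"
    and V0 [measurable]: "random_variable borel V0"
    and sq: "integrable M (\<lambda>\<omega>. (norm (V0 \<omega>))\<^sup>2)"
    and mean: "\<And>a. expectation (\<lambda>\<omega>. a \<bullet> V0 \<omega>) = 0"
    and J: "\<And>N::nat. J N \<subseteq> I"
    and bound: "\<And>N. (\<Sum>j\<in>J N. (norm (a N j))\<^sup>2) \<le> B"
    and small: "\<And>N j. j \<in> J N \<Longrightarrow> (norm (a N j))\<^sup>2 \<le> m N" "\<And>N. 0 \<le> m N" "m \<longlonglongrightarrow> 0"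
    and var: "(\<lambda>N. \<Sum>j\<in>J N. expectation (\<lambda>\<omega>. (a N j \<bullet> V0 \<omega>)\<^sup>2)) \<longlonglongrightarrow> s"
  shows "(\<lambda>N. CLINT \<omega>|M. iexp (\<Sum>j\<in>J N. a N j \<bullet> V j \<omega>)) \<longlonglongrightarrow> complex_of_real (exp (- s / 2))"
proof -
  let ?v = "\<lambda>N j. expectation (\<lambda>\<omega>. (a N j \<bullet> V0 \<omega>)\<^sup>2)"
  let ?c = "expectation (\<lambda>\<omega>. (norm (V0 \<omega>))\<^sup>2)"
  let ?e = "\<lambda>N. expectation (\<lambda>\<omega>. min (6 * (norm (V0 \<omega>))\<^sup>2) (sqrt (m N) * norm (V0 \<omega>) ^ 3))"
  have rv: "random_variable borel (V j)" if "j \<in> I" for j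
    using indep that unfolding indep_vars_def2 by simp
  have char_eq: "(CLINT \<omega>|M. iexp (\<Sum>j\<in>J N. a N j \<bullet> V j \<omega>)) = (\<Prod>j\<in>J N. char (distr M borel (\<lambda>\<omega>. a N j \<bullet> V0 \<omega>)) 1)" for N
  proof -
    have ind: "indep_vars (\<lambda>_. borel) (\<lambda>j \<omega>. a N j \<bullet> V j \<omega>) (J N)"
      by (rule indep_vars_compose2[where X=V, OF indep_vars_subset[OF indep J]]) auto
    have "(\<lambda>\<omega>. \<Sum>j\<in>J N. a N j \<bullet> V j \<omega>) \<in> borel_measurable M"
      using ind unfolding indep_vars_def2 by (intro borel_measurable_sum) auto
    then have "(CLINT \<omega>|M. iexp (\<Sum>j\<in>J N. a N j \<bullet> V j \<omega>)) = char (distr M borel (\<lambda>\<omega>. \<Sum>j\<in>J N. a N j \<bullet> V j \<omega>)) 1"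
      unfolding char_def by (subst integral_distr) auto
    also have "\<dots> = (\<Prod>j\<in>J N. char (distr M borel (\<lambda>\<omega>. a N j \<bullet> V j \<omega>)) 1)"
      by (rule char_distr_sum[OF ind])
    also have "\<dots> = (\<Prod>j\<in>J N. char (distr M borel (\<lambda>\<omega>. a N j \<bullet> V0 \<omega>)) 1)"
    proof (intro prod.cong refl)
      fix j assume "j \<in> J N"
      then have "j \<in> I" using J by auto
      note [measurable] = rv[OF this]
      have "distr M borel (\<lambda>\<omega>. a N j \<bullet> V j \<omega>) = distr (distr M borel (V j)) borel (\<lambda>x. a N j \<bullet> x)"
        by (subst distr_distr) (auto simp: comp_def)
      also have "\<dots> = distr M borel (\<lambda>\<omega>. a N j \<bullet> V0 \<omega>)"
        unfolding distr[OF \<open>j \<in> I\<close>] by (subst distr_distr) (auto simp: comp_def)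
      finally show "char (distr M borel (\<lambda>\<omega>. a N j \<bullet> V j \<omega>)) 1 = char (distr M borel (\<lambda>\<omega>. a N j \<bullet> V0 \<omega>)) 1" by simp
    qed
    finally show ?thesis .
  qed
  \<comment> \<open>The cubic branch tends to 0 pointwise, while the quadratic branch is an
    integrable majorant.\<close>
  have "(\<lambda>N. ?e N) \<longlonglongrightarrow> (\<integral>\<omega>. 0 \<partial>M)"
  proof (rule integral_dominated_convergence[where w="\<lambda>\<omega>. 6 * (norm (V0 \<omega>))\<^sup>2"])
    show "AE \<omega> in M. (\<lambda>N. min (6 * (norm (V0 \<omega>))\<^sup>2) (sqrt (m N) * norm (V0 \<omega>) ^ 3)) \<longlonglongrightarrow> 0"
    proof (rule AE_I2)
      fix \<omega>
      have "(\<lambda>N. min (6 * (norm (V0 \<omega>))\<^sup>2) (sqrt (m N) * norm (V0 \<omega>) ^ 3)) \<longlonglongrightarrow> min (6 * (norm (V0 \<omega>))\<^sup>2) (sqrt 0 * norm (V0 \<omega>) ^ 3)"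
        by (intro tendsto_intros small(3))
      then show "(\<lambda>N. min (6 * (norm (V0 \<omega>))\<^sup>2) (sqrt (m N) * norm (V0 \<omega>) ^ 3)) \<longlonglongrightarrow> 0"
        by (simp add: min_absorb2)
    qed
    show "AE \<omega> in M. norm (min (6 * (norm (V0 \<omega>))\<^sup>2) (sqrt (m N) * norm (V0 \<omega>) ^ 3)) \<le> 6 * (norm (V0 \<omega>))\<^sup>2" for N
      using small(2)[of N] by auto
  qed (use sq in auto)
  then have e_lim: "?e \<longlonglongrightarrow> 0" by simp
  have e_nonneg: "0 \<le> ?e N" for N
    using small(2) by (intro integral_nonneg_AE) auto
  have diff: "norm ((CLINT \<omega>|M. iexp (\<Sum>j\<in>J N. a N j \<bullet> V j \<omega>)) - complex_of_real (exp (- (\<Sum>j\<in>J N. ?v N j) / 2)))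
      \<le> B * (?e N / 6 + m N * ?c\<^sup>2)" for N
  proof -
    \<comment> \<open>For infinite \<open>J N\<close> the sum defaults to 0 and the product to 1,
      and the identity reads \<open>exp 0 = 1\<close>.\<close>
    have "complex_of_real (exp (- (\<Sum>j\<in>J N. ?v N j) / 2)) = (\<Prod>j\<in>J N. complex_of_real (exp (- ?v N j / 2)))"
    proof (cases "finite (J N)")
      case True
      then show ?thesis
        by (simp only: of_real_prod[symmetric] exp_sum[symmetric]) (simp add: sum_negf sum_divide_distrib)
    qed simp
    with char_eq have "norm ((CLINT \<omega>|M. iexp (\<Sum>j\<in>J N. a N j \<bullet> V j \<omega>)) - complex_of_real (exp (- (\<Sum>j\<in>J N. ?v N j) / 2)))
      = norm ((\<Prod>j\<in>J N. char (distr M borel (\<lambda>\<omega>. a N j \<bullet> V0 \<omega>)) 1) - (\<Prod>j\<in>J N. complex_of_real (exp (- ?v N j / 2))))"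
      by simp
    also have "\<dots> \<le> (\<Sum>j\<in>J N. cmod (char (distr M borel (\<lambda>\<omega>. a N j \<bullet> V0 \<omega>)) 1 - complex_of_real (exp (- ?v N j / 2))))"
    proof (intro norm_prod_diff)
      show "cmod (char (distr M borel (\<lambda>\<omega>. a N j \<bullet> V0 \<omega>)) 1) \<le> 1" for j
        by (intro real_distribution.cmod_char_le_1 real_distribution_distr) simp
      show "cmod (complex_of_real (exp (- ?v N j / 2))) \<le> 1" for j
        unfolding norm_of_real by simp
    qed
    also have "\<dots> \<le> (\<Sum>j\<in>J N. (norm (a N j))\<^sup>2 * (?e N / 6 + m N * ?c\<^sup>2))"
      by (intro sum_mono char_inner_approx V0 sq mean small(1))
    also have "\<dots> = (\<Sum>j\<in>J N. (norm (a N j))\<^sup>2) * (?e N / 6 + m N * ?c\<^sup>2)"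
      by (simp add: sum_distrib_right)
    also have "\<dots> \<le> B * (?e N / 6 + m N * ?c\<^sup>2)"
      using e_nonneg small(2) bound by (intro mult_right_mono) auto
    finally show ?thesis .
  qed
  have "(\<lambda>N. B * (?e N / 6 + m N * ?c\<^sup>2)) \<longlonglongrightarrow> B * (0 / 6 + 0 * ?c\<^sup>2)"
    by (intro tendsto_intros e_lim small(3)) simp
  then have "(\<lambda>N. (CLINT \<omega>|M. iexp (\<Sum>j\<in>J N. a N j \<bullet> V j \<omega>)) - complex_of_real (exp (- (\<Sum>j\<in>J N. ?v N j) / 2))) \<longlonglongrightarrow> 0"
    by (intro Lim_null_comparison[OF always_eventually[OF allI], OF diff]) simp
  moreover have "(\<lambda>N. complex_of_real (exp (- (\<Sum>j\<in>J N. ?v N j) / 2))) \<longlonglongrightarrow> complex_of_real (exp (- s / 2))"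
    by (intro tendsto_intros var) simp
  ultimately show ?thesis
    using tendsto_add by fastforce
qed

text \<open>A Slutsky argument: the integrands differ in modulus by
  \<open>cmod (iexp (R N \<omega>) - 1)\<close>, which is at most
  \<open>\<bar>R N \<omega>\<bar>\<close> and never exceeds 2.\<close>

lemma char_add_tendsto:
  fixes A R :: "nat \<Rightarrow> 'a \<Rightarrow> real"
  assumes [measurable]: "\<And>N. A N \<in> borel_measurable M" "\<And>N. R N \<in> borel_measurable M"
    and R: "\<And>e. 0 < e \<Longrightarrow> (\<lambda>N. prob {\<omega> \<in> space M. e < \<bar>R N \<omega>\<bar>}) \<longlonglongrightarrow> 0"
    and lim: "(\<lambda>N. CLINT \<omega>|M. iexp (A N \<omega>)) \<longlonglongrightarrow> l"
  shows "(\<lambda>N. CLINT \<omega>|M. iexp (A N \<omega> + R N \<omega>)) \<longlonglongrightarrow> l"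
proof -
  have int: "integrable M (\<lambda>\<omega>. iexp (f \<omega>))" if [measurable]: "f \<in> borel_measurable M" for f
    using integrable_iexp[of "\<lambda>\<omega>. complex_of_real (f \<omega>)"] by simp
  have bound: "cmod ((CLINT \<omega>|M. iexp (A N \<omega> + R N \<omega>)) - (CLINT \<omega>|M. iexp (A N \<omega>)))
      \<le> e + 2 * prob {\<omega> \<in> space M. e < \<bar>R N \<omega>\<bar>}" if "0 < e" for N e
  proof -
    let ?E = "{\<omega> \<in> space M. e < \<bar>R N \<omega>\<bar>}"
    have ind: "integrable M (indicat_real ?E)"
      by (intro integrable_const_bound[where B=1]) auto
    have "cmod ((CLINT \<omega>|M. iexp (A N \<omega> + R N \<omega>)) - (CLINT \<omega>|M. iexp (A N \<omega>)))
        = cmod (CLINT \<omega>|M. iexp (A N \<omega> + R N \<omega>) - iexp (A N \<omega>))"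
      using int[of "\<lambda>\<omega>. A N \<omega> + R N \<omega>"] int[of "A N"]
      by (subst Bochner_Integration.integral_diff) auto
    also have "\<dots> \<le> (\<integral>\<omega>. e + 2 * indicat_real ?E \<omega> \<partial>M)"
    proof (rule order_trans[OF integral_norm_bound], rule integral_mono)
      fix \<omega> assume "\<omega> \<in> space M"
      have "cmod (iexp (A N \<omega> + R N \<omega>) - iexp (A N \<omega>)) = cmod (iexp (A N \<omega>) * (iexp (R N \<omega>) - 1))"
        by (simp add: exp_add algebra_simps)
      also have "\<dots> = cmod (iexp (R N \<omega>) - 1)" by (simp add: norm_mult)
      also have "\<dots> \<le> e + 2 * indicat_real ?E \<omega>"
      proof (cases "\<omega> \<in> ?E")
        case True
        then show ?thesis
          using norm_triangle_ineq4[of "iexp (R N \<omega>)" 1] \<open>0 < e\<close> by simp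
      next
        case False
        then show ?thesis
          using iexp_approx1[of "R N \<omega>" 0] \<open>\<omega> \<in> space M\<close> by simp
      qed
      finally show "cmod (iexp (A N \<omega> + R N \<omega>) - iexp (A N \<omega>)) \<le> e + 2 * indicat_real ?E \<omega>" .
    next
      show "integrable M (\<lambda>\<omega>. cmod (iexp (A N \<omega> + R N \<omega>) - iexp (A N \<omega>)))"
        using int[of "\<lambda>\<omega>. A N \<omega> + R N \<omega>"] int[of "A N"]
        by (intro integrable_norm Bochner_Integration.integrable_diff) auto
      show "integrable M (\<lambda>\<omega>. e + 2 * indicat_real ?E \<omega>)" using ind by simp
    qed
    also have "\<dots> = e + 2 * prob ?E" using ind by (simp add: prob_space)
    finally show ?thesis .
  qed
  have "(\<lambda>N. (CLINT \<omega>|M. iexp (A N \<omega> + R N \<omega>)) - (CLINT \<omega>|M. iexp (A N \<omega>))) \<longlonglongrightarrow> 0"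
  proof (rule tendstoI)
    fix e :: real assume "0 < e"
    \<comment> \<open>These thresholds make the bound
      \<open>e / 2 + 2 * (e / 4) = e\<close>.\<close>
    then have "\<forall>\<^sub>F N in sequentially. prob {\<omega> \<in> space M. e / 2 < \<bar>R N \<omega>\<bar>} < e / 4"
      by (intro order_tendstoD(2)[OF R]) auto
    then show "\<forall>\<^sub>F N in sequentially. dist ((CLINT \<omega>|M. iexp (A N \<omega> + R N \<omega>)) - (CLINT \<omega>|M. iexp (A N \<omega>))) 0 < e"
    proof eventually_elim
      case (elim N)
      then show ?case using bound[of "e / 2" N] \<open>0 < e\<close> by simp
    qed
  qed
  then show ?thesis using tendsto_add[OF _ lim] by fastforce
qed

text \<open>The remainders are added one at a time; a nonzero coefficient only rescales the
  threshold \<open>e\<close>.\<close>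

lemma char_add_sum_tendsto:
  fixes A :: "nat \<Rightarrow> 'a \<Rightarrow> real" and R :: "'i \<Rightarrow> nat \<Rightarrow> 'a \<Rightarrow> real" and t :: "'i \<Rightarrow> real"
  assumes "finite I" and A: "\<And>N. A N \<in> borel_measurable M"
    and Rm: "\<And>i N. i \<in> I \<Longrightarrow> R i N \<in> borel_measurable M"
    and R: "\<And>i e. i \<in> I \<Longrightarrow> 0 < e \<Longrightarrow> (\<lambda>N. prob {\<omega> \<in> space M. e < \<bar>R i N \<omega>\<bar>}) \<longlonglongrightarrow> 0"
    and lim: "(\<lambda>N. CLINT \<omega>|M. iexp (A N \<omega>)) \<longlonglongrightarrow> l"
  shows "(\<lambda>N. CLINT \<omega>|M. iexp (A N \<omega> + (\<Sum>i\<in>I. t i * R i N \<omega>))) \<longlonglongrightarrow> l"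
  using \<open>finite I\<close> Rm R
proof (induction I rule: finite_induct)
  case empty
  then show ?case using lim by simp
next
  case (insert k I)
  have "(\<lambda>N. prob {\<omega> \<in> space M. e < \<bar>t k * R k N \<omega>\<bar>}) \<longlonglongrightarrow> 0" if "0 < e" for e
  proof (cases "t k = 0")
    case False
    then have "{\<omega> \<in> space M. e < \<bar>t k * R k N \<omega>\<bar>} = {\<omega> \<in> space M. e / \<bar>t k\<bar> < \<bar>R k N \<omega>\<bar>}" for N
      by (auto simp: abs_mult field_simps)
    then show ?thesis
      using insert.prems(2)[of k "e / \<bar>t k\<bar>"] False that by simp
  qed (use that in simp)
  moreover have "(\<lambda>N. CLINT \<omega>|M. iexp (A N \<omega> + (\<Sum>i\<in>I. t i * R i N \<omega>))) \<longlonglongrightarrow> l"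
    using insert by simp
  ultimately have "(\<lambda>N. CLINT \<omega>|M. iexp ((A N \<omega> + (\<Sum>i\<in>I. t i * R i N \<omega>)) + t k * R k N \<omega>)) \<longlonglongrightarrow> l"
    using insert.prems(1) A 
    by (intro char_add_tendsto[where A="\<lambda>N \<omega>. A N \<omega> + (\<Sum>i\<in>I. t i * R i N \<omega>)"]) auto
  then show ?case using insert.hyps by (simp add: add_ac)
qed

end

section \<open>Asymptotically linear statistics on overlapping subsamples\<close>

lemma borel_measurable_vecI:
  fixes f :: "'a \<Rightarrow> real ^ 'n"
  assumes "\<And>i. (\<lambda>x. f x $ i) \<in> borel_measurable M"
  shows "f \<in> borel_measurable M"
  by (rule borel_measurable_euclidean_space[THEN iffD2]) (auto simp: Basis_vec_def inner_axis assms)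

theorem theorem1:
  fixes M :: "'w measure" and E :: "'a measure"
    and X0 :: "'w \<Rightarrow> 'a" and X :: "nat \<Rightarrow> 'w \<Rightarrow> 'a"
    and D :: "'c::finite \<Rightarrow> nat \<Rightarrow> nat set"
    and T :: "'c \<Rightarrow> nat set \<Rightarrow> (nat \<Rightarrow> 'a) \<Rightarrow> real"
    and \<theta> :: "'c \<Rightarrow> real" and \<psi> :: "'c \<Rightarrow> 'a \<Rightarrow> real"
    and n :: "'c \<Rightarrow> nat \<Rightarrow> nat" and r :: "'c \<Rightarrow> nat \<Rightarrow> real"
    and overlap :: "'c \<Rightarrow> 'c \<Rightarrow> nat \<Rightarrow> real"
    and \<rho> :: "'c \<Rightarrow> 'c \<Rightarrow> real"
    and S :: "nat \<Rightarrow> 'w \<Rightarrow> real ^ 'c" and \<Sigma> :: "real ^ 'c ^ 'c"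
  assumes "prob_space M"
    and "X0 \<in> measurable M E"
    and "prob_space.indep_vars M (\<lambda>_. E) X {1..}"
    and "\<And>j. j \<ge> 1 \<Longrightarrow> distr M E (X j) = distr M E X0"
    and "\<And>i N. N \<ge> 1 \<Longrightarrow> D i N \<subseteq> {1..N}"
    and "\<And>i N. n i N = card (D i N)"
    and "\<And>i N. N \<ge> 1 \<Longrightarrow> T i (D i N) \<in> borel_measurable (Pi\<^sub>M (D i N) (\<lambda>_. E))"
    and "\<And>i. asymptotically_linear M E X0 X (D i) (T i) (\<theta> i) (\<psi> i)"
    and "\<And>i N. r i N = real (n i N) / real N"
    and "\<And>i j N. overlap i j N = real (card (D i N \<inter> D j N)) / real N"
    and "\<And>i. filterlim (\<lambda>N. real N * r i N) at_top sequentially"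
    and "\<And>i j. (\<lambda>N. overlap i j N / sqrt (r i N * r j N)) \<longlonglongrightarrow> \<rho> i j"
    and "\<And>N \<omega>. S N \<omega> = (\<chi> i. sqrt (real (n i N)) * (subsample_statistic (T i) X (D i N) \<omega> - \<theta> i))"
    and "\<Sigma> = (\<chi> i j. \<rho> i j * (\<integral>\<omega>. \<psi> i (X0 \<omega>) * \<psi> j (X0 \<omega>) \<partial>M))"
  shows "\<exists>\<nu>. multivariate_normal 0 \<Sigma> \<nu> \<and> converges_in_distribution M S \<nu>"
proof -
  interpret prob_space M by (rule assms(1))
  note D = assms(5) and n = assms(6) and r = assms(9) and overlap = assms(10)
    and \<rho>_lim = assms(12) and S = assms(13) and \<Sigma> = assms(14)
  have \<psi> [measurable]: "\<psi> i \<in> borel_measurable E"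
    and mean: "(\<integral>\<omega>. \<psi> i (X0 \<omega>) \<partial>M) = 0"
    and int: "integrable M (\<lambda>\<omega>. \<psi> i (X0 \<omega>))"
    and sq: "integrable M (\<lambda>\<omega>. (\<psi> i (X0 \<omega>))\<^sup>2)"
    and rem: "small_o_p M
       (\<lambda>N \<omega>. subsample_statistic (T i) X (D i N) \<omega> - \<theta> i
               - (1 / real (card (D i N))) * (\<Sum>j\<in>D i N. \<psi> i (X j \<omega>)))
       (\<lambda>N. real (card (D i N)) powr (- 1 / 2))" for i
    using assms(8)[of i] unfolding asymptotically_linear_def by - (elim conjE, assumption)+
  have X0 [measurable]: "X0 \<in> measurable M E" by fact
  have X: "X j \<in> measurable M E" if "1 \<le> j" for j
    using assms(3) that unfolding indep_vars_def2 by auto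
  \<comment> \<open>The hypotheses say nothing about \<open>N = 0\<close>, so everything is stated for \<open>Suc N\<close>.\<close>
  have D_sub: "D i (Suc N) \<subseteq> {1..Suc N}" for i N
    by (rule D) simp
  define C where "C i k = (\<integral>\<omega>. \<psi> i (X0 \<omega>) * \<psi> k (X0 \<omega>) \<partial>M)" for i k
  have int_C: "integrable M (\<lambda>\<omega>. \<psi> i (X0 \<omega>) * \<psi> k (X0 \<omega>))" for i k
  proof (rule Bochner_Integration.integrable_bound[OF Bochner_Integration.integrable_add[OF sq[of i] sq[of k]]])
    have "\<bar>x * y\<bar> \<le> x\<^sup>2 + y\<^sup>2" for x y :: real
      using sum_squares_bound[of "\<bar>x\<bar>" "\<bar>y\<bar>"] abs_ge_zero[of "x * y"]
      by (simp only: abs_mult power2_abs)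
    then show "AE \<omega> in M. norm (\<psi> i (X0 \<omega>) * \<psi> k (X0 \<omega>)) \<le> norm ((\<psi> i (X0 \<omega>))\<^sup>2 + (\<psi> k (X0 \<omega>))\<^sup>2)"
      by simp
  qed measurable
  \<comment> \<open>Since \<open>1 / sqrt 0 = 0\<close>, an empty subsample simply gets weight
    0.\<close>
  define c where "c i N = 1 / sqrt (real (n i N))" for i N
  have c_lim: "(\<lambda>N. c i (Suc N)) \<longlonglongrightarrow> 0" for i
  proof -
    have "real (Suc N) * r i (Suc N) = real (n i (Suc N))" for N
      by (simp add: r)
    then have "filterlim (\<lambda>N. real (n i (Suc N))) at_top sequentially"
      using filterlim_compose[OF assms(11)[of i] filterlim_Suc] by simp
    then show ?thesis
      unfolding c_def
      by (intro real_tendsto_divide_at_top[OF tendsto_const] filterlim_compose[OF sqrt_at_top])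
  qed
  \<comment> \<open>The factors \<open>Suc N\<close> cancel, so the overlap hypothesis becomes a
    statement about the weights \<open>c\<close>.\<close>
  have c_overlap: "c i (Suc N) * c k (Suc N) * real (card (D i (Suc N) \<inter> D k (Suc N)))
      = overlap i k (Suc N) / sqrt (r i (Suc N) * r k (Suc N))" for i k N
    by (simp add: c_def r overlap real_sqrt_mult real_sqrt_divide)
  have \<rho>_Suc: "(\<lambda>N. c i (Suc N) * c k (Suc N) * real (card (D i (Suc N) \<inter> D k (Suc N)))) \<longlonglongrightarrow> \<rho> i k" for i k
    unfolding c_overlap using LIMSEQ_Suc[OF \<rho>_lim[of i k]] .
  \<comment> \<open>Symmetry of the limits comes from uniqueness of limits, the prelimit expression
    being symmetric.\<close>
  have \<rho>_sym: "\<rho> i k = \<rho> k i" for i k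
  proof (rule LIMSEQ_unique[OF \<rho>_Suc])
    show "(\<lambda>N. c i (Suc N) * c k (Suc N) * real (card (D i (Suc N) \<inter> D k (Suc N)))) \<longlonglongrightarrow> \<rho> k i"
      using \<rho>_Suc[of k i] by (simp add: mult.commute Int_commute)
  qed

  \<comment> \<open>The influence functions as iid random vectors\<close>
  define V where "V j \<omega> = (\<chi> i. \<psi> i (X j \<omega>))" for j \<omega>
  define V0 where "V0 \<omega> = (\<chi> i. \<psi> i (X0 \<omega>))" for \<omega>
  define g where "g x = (\<chi> i. \<psi> i x)" for x
  have g [measurable]: "g \<in> borel_measurable E"
    by (intro borel_measurable_vecI) (simp add: g_def)
  have V0 [measurable]: "V0 \<in> borel_measurable M"
    by (intro borel_measurable_vecI) (simp add: V0_def)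
  have V_indep: "indep_vars (\<lambda>_. borel) V {1..}"
    using indep_vars_compose2[OF assms(3), of "\<lambda>_. g" "\<lambda>_. borel"] g
    by (simp add: V_def[abs_def] g_def)
  have V_distr: "distr M borel (V j) = distr M borel V0" if "j \<in> {1..}" for j
  proof -
    have "distr M borel (V j) = distr (distr M E (X j)) borel g"
      using X[of j] that by (subst distr_distr) (auto simp: comp_def V_def[abs_def] g_def)
    also have "\<dots> = distr M borel V0"
      using that assms(4)[of j] by (simp add: distr_distr) (simp add: comp_def V0_def[abs_def] g_def)
    finally show ?thesis .
  qed
  have V0_sq: "integrable M (\<lambda>\<omega>. (norm (V0 \<omega>))\<^sup>2)"
    unfolding power2_norm_eq_inner using sq by (simp add: V0_def inner_vec_def power2_eq_square)
  have V0_mean: "(\<integral>\<omega>. a \<bullet> V0 \<omega> \<partial>M) = 0" for a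
    using int by (simp add: V0_def inner_vec_def mean)
  have V0_var: "(\<integral>\<omega>. (a \<bullet> V0 \<omega>)\<^sup>2 \<partial>M) = (\<Sum>i\<in>UNIV. \<Sum>k\<in>UNIV. a $ i * a $ k * C i k)" for a
  proof -
    have "(a \<bullet> V0 \<omega>)\<^sup>2 = (\<Sum>i\<in>UNIV. \<Sum>k\<in>UNIV. a $ i * a $ k * (\<psi> i (X0 \<omega>) * \<psi> k (X0 \<omega>)))" for \<omega>
      by (simp add: V0_def inner_vec_def power2_eq_square sum_product mult_ac)
    then show ?thesis
      using int_C by (simp add: C_def)
  qed

  \<comment> \<open>Weights of the observations and the limiting variance\<close>
  define a where "a t N j = (\<chi> i. t $ i * c i (Suc N) * of_bool (j \<in> D i (Suc N)))" for t :: "real ^ 'c" and N and j :: nat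
  have restrict_sum: "(\<Sum>j = 1..Suc N. of_bool (j \<in> A) * h j) = sum h A"
    if "A \<subseteq> {1..Suc N}" for A N and h :: "nat \<Rightarrow> real"
  proof -
    have "(\<Sum>j = 1..Suc N. of_bool (j \<in> A) * h j) = (\<Sum>j \<in> {1..Suc N}. if j \<in> A then h j else 0)"
      by (intro sum.cong) auto
    also have "\<dots> = sum h ({1..Suc N} \<inter> A)"
      by (rule sum.inter_restrict[symmetric]) simp
    also have "{1..Suc N} \<inter> A = A" using that by blast
    finally show ?thesis .
  qed
  \<comment> \<open>Exchanging the sums counts, for each pair of components, the observations shared
    by their two subsamples.\<close>
  have var: "(\<lambda>N. \<Sum>j = 1..Suc N. \<integral>\<omega>. (a t N j \<bullet> V0 \<omega>)\<^sup>2 \<partial>M) \<longlonglongrightarrow> t \<bullet> (\<Sigma> *v t)" for t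
  proof -
    have "(\<Sum>j = 1..Suc N. \<integral>\<omega>. (a t N j \<bullet> V0 \<omega>)\<^sup>2 \<partial>M)
        = (\<Sum>i\<in>UNIV. \<Sum>k\<in>UNIV. t $ i * t $ k * C i k *
            (c i (Suc N) * c k (Suc N) * real (card (D i (Suc N) \<inter> D k (Suc N)))))" for N
    proof -
      have "(\<Sum>j = 1..Suc N. \<integral>\<omega>. (a t N j \<bullet> V0 \<omega>)\<^sup>2 \<partial>M)
          = (\<Sum>j = 1..Suc N. \<Sum>i\<in>UNIV. \<Sum>k\<in>UNIV.
              of_bool (j \<in> D i (Suc N) \<inter> D k (Suc N)) * (t $ i * t $ k * C i k * (c i (Suc N) * c k (Suc N))))"
        unfolding V0_var by (intro sum.cong refl) (simp add: a_def)
      also have "\<dots> = (\<Sum>i\<in>UNIV. \<Sum>j = 1..Suc N. \<Sum>k\<in>UNIV.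
              of_bool (j \<in> D i (Suc N) \<inter> D k (Suc N)) * (t $ i * t $ k * C i k * (c i (Suc N) * c k (Suc N))))"
        by (rule sum.swap)
      also have "\<dots> = (\<Sum>i\<in>UNIV. \<Sum>k\<in>UNIV. \<Sum>j = 1..Suc N.
              of_bool (j \<in> D i (Suc N) \<inter> D k (Suc N)) * (t $ i * t $ k * C i k * (c i (Suc N) * c k (Suc N))))"
        by (rule sum.cong[OF refl], rule sum.swap)
      also have "\<dots> = (\<Sum>i\<in>UNIV. \<Sum>k\<in>UNIV. \<Sum>j\<in>D i (Suc N) \<inter> D k (Suc N).
              t $ i * t $ k * C i k * (c i (Suc N) * c k (Suc N)))"
        by (rule sum.cong[OF refl], rule sum.cong[OF refl], rule restrict_sum) (use D_sub in blast)
      finally show ?thesis by (simp add: mult_ac)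
    qed
    moreover have "(\<lambda>N. \<Sum>i\<in>UNIV. \<Sum>k\<in>UNIV. t $ i * t $ k * C i k *
            (c i (Suc N) * c k (Suc N) * real (card (D i (Suc N) \<inter> D k (Suc N)))))
        \<longlonglongrightarrow> (\<Sum>i\<in>UNIV. \<Sum>k\<in>UNIV. t $ i * t $ k * C i k * \<rho> i k)"
      by (intro tendsto_sum tendsto_mult tendsto_const \<rho>_Suc)
    moreover have "(\<Sum>i\<in>UNIV. \<Sum>k\<in>UNIV. t $ i * t $ k * C i k * \<rho> i k) = t \<bullet> (\<Sigma> *v t)"
      unfolding \<Sigma> by (simp add: inner_vec_def matrix_vector_mult_def C_def sum_distrib_left mult_ac)
    ultimately show ?thesis by simp
  qed
  have psd: "0 \<le> t \<bullet> (\<Sigma> *v t)" for t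
    by (rule LIMSEQ_le_const[OF var], intro exI allI impI sum_nonneg) simp
  have sym: "\<Sigma> $ i $ j = \<Sigma> $ j $ i" for i j
    unfolding \<Sigma> by (simp add: \<rho>_sym[of i j] mult.commute)
  obtain A :: "real ^ 'c ^ 'c" where A: "A ** transpose A = \<Sigma>"
    using psd_imp_matrix_square_root[OF sym psd] .

  \<comment> \<open>Linear part and remainder\<close>
  define L where "L i N \<omega> = c i (Suc N) * (\<Sum>j\<in>D i (Suc N). \<psi> i (X j \<omega>))" for i N \<omega>
  define R where "R i N \<omega> = S (Suc N) \<omega> $ i - L i N \<omega>" for i N \<omega>
  have \<psi>X: "(\<lambda>\<omega>. \<psi> i (X j \<omega>)) \<in> borel_measurable M" if "j \<in> D k (Suc N)" for i j k N
  proof -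
    from that D_sub have "1 \<le> j" by fastforce
    from measurable_compose[OF X[OF this] \<psi>] show ?thesis .
  qed
  have L_meas: "(\<lambda>\<omega>. L i N \<omega>) \<in> borel_measurable M" for i N
    unfolding L_def by (intro borel_measurable_times borel_measurable_const borel_measurable_sum \<psi>X)
  have S_meas_i: "(\<lambda>\<omega>. S (Suc N) \<omega> $ i) \<in> borel_measurable M" for i N
  proof -
    have "(\<lambda>\<omega>. \<lambda>j\<in>D i (Suc N). X j \<omega>) \<in> measurable M (Pi\<^sub>M (D i (Suc N)) (\<lambda>_. E))"
    proof (rule measurable_restrict)
      fix j assume "j \<in> D i (Suc N)"
      with D_sub have "1 \<le> j" by fastforce
      then show "X j \<in> measurable M E" by (rule X)
    qed
    from measurable_compose[OF this assms(7)[of "Suc N" i]]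
    have "(\<lambda>\<omega>. subsample_statistic (T i) X (D i (Suc N)) \<omega>) \<in> borel_measurable M"
      by (simp add: subsample_statistic_def)
    then have "(\<lambda>\<omega>. sqrt (real (n i (Suc N))) * (subsample_statistic (T i) X (D i (Suc N)) \<omega> - \<theta> i)) \<in> borel_measurable M"
      by (intro borel_measurable_times borel_measurable_diff borel_measurable_const)
    then show ?thesis unfolding S vec_lambda_beta .
  qed
  have S_meas: "S (Suc N) \<in> borel_measurable M" for N
    by (intro borel_measurable_vecI S_meas_i)
  have R_meas: "(\<lambda>\<omega>. R i N \<omega>) \<in> borel_measurable M" for i N
    unfolding R_def by (intro borel_measurable_diff S_meas_i L_meas)
  have R_small: "(\<lambda>N. prob {\<omega> \<in> space M. e < \<bar>R i N \<omega>\<bar>}) \<longlonglongrightarrow> 0" if "0 < e" for i e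
  proof -
    \<comment> \<open>Multiplying by \<open>sqrt n\<close> is dividing by
      \<open>n powr (- 1 / 2)\<close>, so \<open>R\<close> is exactly the ratio in
      \<open>small_o_p\<close>. For \<open>n = 0\<close> both sides are 0 by the conventions for
      division and \<open>powr\<close>.\<close>
    have "R i N \<omega> = (subsample_statistic (T i) X (D i (Suc N)) \<omega> - \<theta> i
               - (1 / real (card (D i (Suc N)))) * (\<Sum>j\<in>D i (Suc N). \<psi> i (X j \<omega>)))
             / real (card (D i (Suc N))) powr (- 1 / 2)" for N \<omega>
    proof (cases "n i (Suc N) = 0")
      case False
      define q where "q = sqrt (real (n i (Suc N)))"
      have "q \<noteq> 0" "real (n i (Suc N)) = q * q" "real (n i (Suc N)) powr (- 1 / 2) = 1 / q"
        using False by (simp_all add: q_def powr_minus_divide powr_half_sqrt)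
      then show ?thesis
        unfolding R_def S L_def c_def n[symmetric] vec_lambda_beta q_def[symmetric]
        by (simp add: field_simps)
    qed (simp add: R_def S L_def c_def n)
    then show ?thesis
      using LIMSEQ_Suc[OF rem[of i, unfolded small_o_p_def, rule_format, OF that]] by simp
  qed

  \<comment> \<open>Characteristic functions of the linear part and of the statistics\<close>
  have char_lin: "(\<lambda>N. CLINT \<omega>|M. iexp (\<Sum>i\<in>UNIV. t $ i * L i N \<omega>))
      \<longlonglongrightarrow> complex_of_real (exp (- (t \<bullet> (\<Sigma> *v t)) / 2))" for t
  proof -
    \<comment> \<open>Dropping the membership indicators gives a bound uniform in \<open>j\<close>;
      it vanishes because every \<open>c i\<close> does.\<close>
    define m where "m N = (\<Sum>i\<in>UNIV. (t $ i * c i (Suc N))\<^sup>2)" for N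
    have norm_a: "(norm (a t N j))\<^sup>2 = (\<Sum>i\<in>UNIV. of_bool (j \<in> D i (Suc N)) * (t $ i * c i (Suc N))\<^sup>2)" for N j
      unfolding a_def power2_norm_eq_inner inner_vec_def
      by (rule sum.cong) (auto simp: power2_eq_square)
    have "(\<lambda>N. CLINT \<omega>|M. iexp (\<Sum>j = 1..Suc N. a t N j \<bullet> V j \<omega>))
        \<longlonglongrightarrow> complex_of_real (exp (- (t \<bullet> (\<Sigma> *v t)) / 2))"
    proof (rule char_weighted_iid_sum_tendsto[OF V_indep V_distr V0 V0_sq V0_mean])
      \<comment> \<open>Component \<open>i\<close> contributes its squared weight,
        \<open>(t $ i)\<^sup>2\<close> over the subsample size, once per member of a nonempty
        subsample, and 0 for an empty one.\<close>
      show "(\<Sum>j = 1..Suc N. (norm (a t N j))\<^sup>2) \<le> (\<Sum>i\<in>UNIV. (t $ i)\<^sup>2)" for N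
      proof -
        have "(\<Sum>j = 1..Suc N. (norm (a t N j))\<^sup>2)
            = (\<Sum>i\<in>UNIV. \<Sum>j = 1..Suc N. of_bool (j \<in> D i (Suc N)) * (t $ i * c i (Suc N))\<^sup>2)"
          unfolding norm_a by (rule sum.swap)
        also have "\<dots> = (\<Sum>i\<in>UNIV. \<Sum>j\<in>D i (Suc N). (t $ i * c i (Suc N))\<^sup>2)"
          by (rule sum.cong[OF refl], rule restrict_sum) (use D_sub in blast)
        also have "\<dots> \<le> (\<Sum>i\<in>UNIV. (t $ i)\<^sup>2)"
          by (intro sum_mono) (simp add: c_def n power_mult_distrib power_divide)
        finally show ?thesis .
      qed
      show "(norm (a t N j))\<^sup>2 \<le> m N" for N j
        unfolding norm_a m_def by (intro sum_mono) simp
      show "0 \<le> m N" for N unfolding m_def by (simp add: sum_nonneg)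
      have "m \<longlonglongrightarrow> (\<Sum>i\<in>UNIV. (t $ i * 0)\<^sup>2)"
        unfolding m_def by (intro tendsto_intros c_lim)
      then show "m \<longlonglongrightarrow> 0" by simp
    qed (use var in auto)
    \<comment> \<open>Regrouping by observations instead of components; this identity dictates the
      form of \<open>a\<close>.\<close>
    moreover have "(\<Sum>j = 1..Suc N. a t N j \<bullet> V j \<omega>) = (\<Sum>i\<in>UNIV. t $ i * L i N \<omega>)" for N \<omega>
    proof -
      have "(\<Sum>j = 1..Suc N. a t N j \<bullet> V j \<omega>)
          = (\<Sum>j = 1..Suc N. \<Sum>i\<in>UNIV. of_bool (j \<in> D i (Suc N)) * (t $ i * c i (Suc N) * \<psi> i (X j \<omega>)))"
        by (simp add: a_def V_def inner_vec_def mult_ac)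
      also have "\<dots> = (\<Sum>i\<in>UNIV. \<Sum>j = 1..Suc N. of_bool (j \<in> D i (Suc N)) * (t $ i * c i (Suc N) * \<psi> i (X j \<omega>)))"
        by (rule sum.swap)
      also have "\<dots> = (\<Sum>i\<in>UNIV. \<Sum>j\<in>D i (Suc N). t $ i * c i (Suc N) * \<psi> i (X j \<omega>))"
        by (rule sum.cong[OF refl], rule restrict_sum) (use D_sub in blast)
      finally show ?thesis by (simp add: L_def sum_distrib_left mult_ac)
    qed
    ultimately show ?thesis by (simp only:)
  qed
  have char_S: "(\<lambda>N. CLINT \<omega>|M. iexp (t \<bullet> S (Suc N) \<omega>))
      \<longlonglongrightarrow> complex_of_real (exp (- (t \<bullet> (\<Sigma> *v t)) / 2))" for t
  proof -
    have "t \<bullet> S (Suc N) \<omega> = (\<Sum>i\<in>UNIV. t $ i * L i N \<omega>) + (\<Sum>i\<in>UNIV. t $ i * R i N \<omega>)" for N \<omega>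
      by (simp add: inner_vec_def R_def right_diff_distrib sum_subtractf)
    moreover have "(\<lambda>N. CLINT \<omega>|M. iexp ((\<Sum>i\<in>UNIV. t $ i * L i N \<omega>) + (\<Sum>i\<in>UNIV. t $ i * R i N \<omega>)))
        \<longlonglongrightarrow> complex_of_real (exp (- (t \<bullet> (\<Sigma> *v t)) / 2))"
      by (rule char_add_sum_tendsto[OF finite _ R_meas R_small char_lin])
        (intro borel_measurable_sum borel_measurable_times borel_measurable_const L_meas)
    ultimately show ?thesis by (simp only:)
  qed

  \<comment> \<open>The normal limit law\<close>
  let ?\<nu> = "distr std_normal_vec borel (\<lambda>z. 0 + A *v z)"
  have A_meas: "(\<lambda>z. 0 + A *v z) \<in> measurable std_normal_vec borel"
    unfolding measurable_cong_sets[OF sets_std_normal_vec refl]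
    by (intro borel_measurable_continuous_onI continuous_intros linear_continuous_on) simp
  have "(\<lambda>N. \<integral>\<omega>. f (S N \<omega>) \<partial>M) \<longlonglongrightarrow> (\<integral>y. f y \<partial>?\<nu>)"
    if f: "continuous_on UNIV f" "bounded (range f)" for f :: "real ^ 'c \<Rightarrow> real"
  proof (rule LIMSEQ_imp_Suc)
    have "(\<lambda>N. integral\<^sup>L (distr M borel (S (Suc N))) f) \<longlonglongrightarrow> integral\<^sup>L ?\<nu> f"
    proof (rule levy_continuity_euclidean[OF _ _ _ _ _ f])
      show "(\<lambda>N. CLINT x|distr M borel (S (Suc N)). iexp (t \<bullet> x)) \<longlonglongrightarrow> (CLINT x|?\<nu>. iexp (t \<bullet> x))" for t
        unfolding char_affine_std_normal_vec[OF A] using char_S[of t] S_meas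
        by (subst integral_distr) auto
      show "prob_space (distr M borel (S (Suc N)))" for N
        by (rule prob_space_distr[OF S_meas])
      show "prob_space ?\<nu>"
        by (rule prob_space.prob_space_distr[OF prob_space_std_normal_vec A_meas])
    qed simp_all
    then show "(\<lambda>N. \<integral>\<omega>. f (S (Suc N) \<omega>) \<partial>M) \<longlonglongrightarrow> (\<integral>y. f y \<partial>?\<nu>)"
      using borel_measurable_continuous_onI[OF f(1)] by (simp only: integral_distr[OF S_meas])
  qed
  then show ?thesis
    unfolding multivariate_normal_def converges_in_distribution_def using A by blast
qed

end
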